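(* Let $m,n,d,N\ge 1$ be integers, let $\mathbf{u}^{(1)},\dots,\mathbf{u}^{(N)}\in\mathbb{R}^m$ be sampling points, let $\mathbf{A}\in\mathbb{R}^{\delta\times N}$ be the Vandermonde-like matrix of these points, and for a polynomial map $\mathbf{f}:\mathbb{R}^m\to\mathbb{R}^n$ of total degree at most $d$ without constant terms let $\mathcal{Q}=\mathcal{Q}(\mathbf{f})\in\mathbb{R}^{n\times m\times\delta}$ be its tensor of unfoldings and $\mathcal{J}=\mathcal{J}(\mathbf{f})\in\mathbb{R}^{n\times m\times N}$ its tensor of Jacobian matrices (all defined in the context). Put $M:=\binom{m+d-1}{d-1}$. 1. For every such polynomial map $\mathbf{f}$, $$\mathcal{J}=\mathcal{Q}\bullet_3\mathbf{A}^\top .$$ 2. $\operatorname{rank}\mathbf{A}\le M$. In addition, if $M\le N$ and some $M$ of the points $\mathbf{u}^{(1)},\dots,\mathbf{u}^{(N)}$ are in general position, then $\operatorname{rank}\mathbf{A}=M$. That is, there is a proper algebraic subset $Z\subsetneq(\mathbb{R}^m)^M$, depending only on $m$ and $d$, such that $\operatorname{rank}\mathbf{A}=M$ whenever some $M$ of the sampling points form an $M$-tuple lying outside $Z$. In particular, if $M\le N$ and the points $\mathbf{u}^{(j)}$ are independent and sampled from a probability distribution on $\mathbb{R}^m$ that is absolutely continuous with respect to Lebesgue measure, then $\operatorname{rank}\mathbf{A}=M$ with probability $1$. 3. Suppose $\operatorname{rank}\mathbf{A}=M$. Then for every such $\mathbf{f}$, $$\operatorname{rank}\mathcal{J}=\operatorname{rank}\mathcal{Q}$$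 (CP ranks), and the minimal CP decompositions of $\mathcal{Q}$ and of $\mathcal{J}$ differ only by their third factors, which are linked by $\mathbf{h}_k=\mathbf{A}^\top\mathbf{z}_k$: if $\mathcal{Q}=\sum_{k=1}^{r}\mathbf{w}_k\circ\mathbf{v}_k\circ\mathbf{z}_k$ is a minimal CP decomposition, then $\mathcal{J}=\sum_{k=1}^{r}\mathbf{w}_k\circ\mathbf{v}_k\circ(\mathbf{A}^\top\mathbf{z}_k)$ is a minimal CP decomposition, and every minimal CP decomposition of $\mathcal{J}$ arises in this way from a minimal CP decomposition of $\mathcal{Q}$. Moreover, if the minimal CP decomposition of $\mathcal{Q}$ is unique, then the minimal CP decomposition of $\mathcal{J}$ is also unique.
   Context: Polynomial maps. $\mathbf{f}=(f_1,\dots,f_n)^\top:\mathbb{R}^m\to\mathbb{R}^n$ has components $f_i$ that are real polynomials in $\mathbf{u}=(u_1,\dots,u_m)^\top$ of total degree at most $d$ with zero constant term. Tensor of unfoldings. Let $\delta=\sum_{k=1}^{d}m^{k-1}$. Every polynomial $p$ of degree at most $d$ with zero constant term can be written uniquely as $p(\mathbf{u})=\sum_{s=1}^{d}\sum_{i_1,\dots,i_s=1}^{m}\Psi^{(s)}_{i_1,\dots,i_s}u_{i_1}\cdots u_{i_s}$ with $\Psi^{(s)}\in\mathbb{R}^{m\times\cdots\times m}$ a symmetric tensor of order $s$ (a vector for $s=1$). Let $\Psi^{(s)}_{(1)}\in\mathbb{R}^{m\times m^{s-1}}$ be the first-mode unfolding, whose $i$-th row is the (column-major) vectorization of the slice $\Psi^{(s)}_{i,:,\dots,:}$.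 Define $\Psi(p)=[\,\Psi^{(1)}\mid\Psi^{(2)}\mid\Psi^{(3)}_{(1)}\mid\cdots\mid\Psi^{(d)}_{(1)}\,]\in\mathbb{R}^{m\times\delta}$. The tensor $\mathcal{Q}=\mathcal{Q}(\mathbf{f})\in\mathbb{R}^{n\times m\times\delta}$ has slices $\mathcal{Q}_{i,:,:}=\Psi(f_i)$, $i=1,\dots,n$. Tensor of Jacobians. $\mathcal{J}=\mathcal{J}(\mathbf{f})\in\mathbb{R}^{n\times m\times N}$ is given by $\mathcal{J}_{i,j,l}=\frac{\partial f_i}{\partial u_j}(\mathbf{u}^{(l)})$. Vandermonde-like matrix. $\mathbf{A}\in\mathbb{R}^{\delta\times N}$ has $j$-th column $$\mathbf{A}_{:,j}=\big[\,1\mid 2(\mathbf{u}^{(j)})^\top\mid 3(\mathbf{u}^{(j)}\otimes\mathbf{u}^{(j)})^\top\mid\cdots\mid d(\underbrace{\mathbf{u}^{(j)}\otimes\cdots\otimes\mathbf{u}^{(j)}}_{d-1})^\top\,\big]^\top,$$ where $\otimes$ is the Kronecker product. Mode product. For $\mathcal{X}\in\mathbb{R}^{n\times m\times\delta}$, $(\mathcal{X}\bullet_3\mathbf{A}^\top)_{i,j,l}=\sum_{p=1}^{\delta}\mathcal{X}_{i,j,p}\,\mathbf{A}_{p,l}$. CP decomposition. $(\mathbf{u}\circ\mathbf{v}\circ\mathbf{w})_{i,j,k}=u_iv_jw_k$. A CP decomposition of a third-order real tensor $\mathcal{T}$ is an expression $\mathcal{T}=\sum_{k=1}^r\mathbf{a}_k\circ\mathbf{b}_k\circ\mathbf{c}_k$;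 the CP rank $\operatorname{rank}\mathcal{T}$ is the smallest possible $r$, and the decomposition is minimal if $r=\operatorname{rank}\mathcal{T}$. The minimal CP decomposition is called unique if any two minimal CP decompositions have the same rank-one terms up to reordering (equivalently, the factors agree up to permutation and scaling of the vectors within each term). *)

theory Defs
  imports
    "HOL-Probability.Probability"
    "HOL-Library.Poly_Mapping"
    "Jordan_Normal_Form.DL_Rank"
begin

text \<open>
  Indices start at 0. Points of $R^m$ are functions that are \<^const>\<open>undefined\<close> outside
  \<open>{..<m}\<close>, so that $R^m$ is the space of the product measure \<open>Pi\<^sub>M {..<m} (\<lambda>_. lborel)\<close>, which
  is Lebesgue measure. Matrices and the factors of CP decompositions use the types of
  \<^theory>\<open>Jordan_Normal_Form.Matrix\<close>.
\<close>

no_notation vec_nth (infixl \<open>$\<close> 90)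
hide_const (open) Finite_Cartesian_Product.vec Finite_Cartesian_Product.mat
  Finite_Cartesian_Product.row
hide_type (open) Finite_Cartesian_Product.vec

abbreviation (input) "keys \<equiv> Poly_Mapping.keys"
abbreviation (input) "lookup \<equiv> Poly_Mapping.lookup"

abbreviation R_pow :: "nat \<Rightarrow> (nat \<Rightarrow> real) set" where
  "R_pow m \<equiv> {..<m} \<rightarrow>\<^sub>E UNIV"

text \<open>A polynomial maps monomials (finitely supported exponent functions) to coefficients.\<close>

type_synonym 'v mpoly = "('v \<Rightarrow>\<^sub>0 nat) \<Rightarrow>\<^sub>0 real"

definition polys_in :: "'v set \<Rightarrow> 'v mpoly set" where
  "polys_in V = {p. \<forall>t\<in>keys p. keys t \<subseteq> V}"

definition monom_deg :: "('v \<Rightarrow>\<^sub>0 nat) \<Rightarrow> nat" where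
  "monom_deg t = (\<Sum>v\<in>keys t. lookup t v)"

definition poly_eval :: "'v mpoly \<Rightarrow> ('v \<Rightarrow> real) \<Rightarrow> real" where
  "poly_eval p x = (\<Sum>t\<in>keys p. lookup p t * (\<Prod>v\<in>keys t. x v ^ lookup t v))"

definition poly_space :: "nat \<Rightarrow> nat \<Rightarrow> nat mpoly set" where
  "poly_space m d =
     {p \<in> polys_in {..<m}. (\<forall>t\<in>keys p. monom_deg t \<le> d) \<and> lookup p 0 = 0}"

definition poly_maps :: "nat \<Rightarrow> nat \<Rightarrow> nat \<Rightarrow> (nat \<Rightarrow> nat mpoly) set" where
  "poly_maps m n d = {..<n} \<rightarrow> poly_space m d"

definition partial_deriv :: "nat \<Rightarrow> ((nat \<Rightarrow> real) \<Rightarrow> real) \<Rightarrow> (nat \<Rightarrow> real) \<Rightarrow> real" where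
  "partial_deriv j g x = deriv (\<lambda>t. g (x(j := t))) (x j)"

text \<open>An algebraic subset of $(R^m)^M$; the variable \<open>(k, i)\<close> is coordinate \<open>i\<close> of point \<open>k\<close>.\<close>

definition algebraic_subset :: "nat \<Rightarrow> nat \<Rightarrow> (nat \<Rightarrow> nat \<Rightarrow> real) set \<Rightarrow> bool" where
  "algebraic_subset M m Z \<longleftrightarrow>
     (\<exists>P \<subseteq> polys_in ({..<M} \<times> {..<m}). finite P \<and>
        Z = {x \<in> {..<M} \<rightarrow>\<^sub>E R_pow m. \<forall>p\<in>P. poly_eval p (\<lambda>(k, i). x k i) = 0})"

text \<open>
  Tensors are \<^const>\<open>undefined\<close> outside their index box, so that \<open>=\<close> is equality of tensors
  of a given format; the format is passed separately.
\<close>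

type_synonym tensor3 = "nat \<times> nat \<times> nat \<Rightarrow> real"

definition tensor3 :: "nat \<Rightarrow> nat \<Rightarrow> nat \<Rightarrow> (nat \<Rightarrow> nat \<Rightarrow> nat \<Rightarrow> real) \<Rightarrow> tensor3" where
  "tensor3 a b c T = restrict (\<lambda>(i, j, k). T i j k) ({..<a} \<times> {..<b} \<times> {..<c})"

definition mode3_prod :: "nat \<Rightarrow> nat \<Rightarrow> tensor3 \<Rightarrow> real mat \<Rightarrow> tensor3" where
  "mode3_prod a b X B =
     tensor3 a b (dim_row B) (\<lambda>i j l. \<Sum>p<dim_col B. X (i, j, p) * B $$ (l, p))"

definition outer3 :: "real vec \<Rightarrow> real vec \<Rightarrow> real vec \<Rightarrow> tensor3" where
  "outer3 x y z = tensor3 (dim_vec x) (dim_vec y) (dim_vec z) (\<lambda>i j k. x $ i * y $ j * z $ k)"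

definition cp_decomp ::
  "nat \<Rightarrow> nat \<Rightarrow> nat \<Rightarrow> tensor3 \<Rightarrow> nat \<Rightarrow>
   (nat \<Rightarrow> real vec) \<Rightarrow> (nat \<Rightarrow> real vec) \<Rightarrow> (nat \<Rightarrow> real vec) \<Rightarrow> bool" where
  "cp_decomp a b c T r x y z \<longleftrightarrow>
     (\<forall>k<r. x k \<in> carrier_vec a \<and> y k \<in> carrier_vec b \<and> z k \<in> carrier_vec c) \<and>
     T = tensor3 a b c (\<lambda>i j l. \<Sum>k<r. outer3 (x k) (y k) (z k) (i, j, l))"

definition cp_rank :: "nat \<Rightarrow> nat \<Rightarrow> nat \<Rightarrow> tensor3 \<Rightarrow> nat" where
  "cp_rank a b c T = (LEAST r. \<exists>x y z. cp_decomp a b c T r x y z)"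

definition minimal_cp_decomp ::
  "nat \<Rightarrow> nat \<Rightarrow> nat \<Rightarrow> tensor3 \<Rightarrow> nat \<Rightarrow>
   (nat \<Rightarrow> real vec) \<Rightarrow> (nat \<Rightarrow> real vec) \<Rightarrow> (nat \<Rightarrow> real vec) \<Rightarrow> bool" where
  "minimal_cp_decomp a b c T r x y z \<longleftrightarrow> cp_decomp a b c T r x y z \<and> r = cp_rank a b c T"

definition unique_minimal_cp :: "nat \<Rightarrow> nat \<Rightarrow> nat \<Rightarrow> tensor3 \<Rightarrow> bool" where
  "unique_minimal_cp a b c T \<longleftrightarrow>
     (\<forall>r x y z x' y' z'.
        minimal_cp_decomp a b c T r x y z \<longrightarrow> minimal_cp_decomp a b c T r x' y' z' \<longrightarrow>
        (\<exists>\<pi>. \<pi> permutes {..<r} \<and>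
           (\<forall>k<r. outer3 (x k) (y k) (z k) = outer3 (x' (\<pi> k)) (y' (\<pi> k)) (z' (\<pi> k)))))"

definition delta :: "nat \<Rightarrow> nat \<Rightarrow> nat" where
  "delta m d = (\<Sum>k=1..d. m ^ (k - 1))"

definition multi_indices :: "nat \<Rightarrow> nat \<Rightarrow> nat list set" where
  "multi_indices m s = {is. length is = s \<and> set is \<subseteq> {..<m}}"

text \<open>
  A single function on lists holds the symmetric tensors of all orders $1, \ldots, d$:
  the order-\<open>s\<close> tensor is its restriction to lists of length \<open>s\<close>.
\<close>

definition represents_poly :: "nat \<Rightarrow> nat \<Rightarrow> nat mpoly \<Rightarrow> (nat list \<Rightarrow> real) \<Rightarrow> bool" where
  "represents_poly m d p \<Psi> \<longleftrightarrow>
     \<Psi> \<in> extensional (\<Union>s\<in>{1..d}. multi_indices m s) \<and>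
     (\<forall>s\<in>{1..d}. \<forall>is\<in>multi_indices m s. \<forall>js\<in>multi_indices m s.
        mset is = mset js \<longrightarrow> \<Psi> is = \<Psi> js) \<and>
     (\<forall>x\<in>R_pow m.
        poly_eval p x = (\<Sum>s=1..d. \<Sum>is\<in>multi_indices m s. \<Psi> is * (\<Prod>i\<leftarrow>is. x i)))"

definition sym_tensors :: "nat \<Rightarrow> nat \<Rightarrow> nat mpoly \<Rightarrow> nat list \<Rightarrow> real" where
  "sym_tensors m d p = (THE \<Psi>. represents_poly m d p \<Psi>)"

text \<open>
  \<open>digits m k c\<close> is the multi-index of length \<open>k\<close> at position \<open>c\<close> in column-major order,
  where the first index varies fastest.
\<close>

fun digits :: "nat \<Rightarrow> nat \<Rightarrow> nat \<Rightarrow> nat list" where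
  "digits m 0 c = []"
| "digits m (Suc k) c = (c mod m) # digits m k (c div m)"

definition vectorize :: "nat \<Rightarrow> nat \<Rightarrow> (nat list \<Rightarrow> real) \<Rightarrow> real vec" where
  "vectorize m k T = vec (m ^ k) (\<lambda>c. T (digits m k c))"

definition unfolding1 :: "nat \<Rightarrow> nat \<Rightarrow> (nat list \<Rightarrow> real) \<Rightarrow> real mat" where
  "unfolding1 m s T =
     mat_of_rows (m ^ (s - 1)) (map (\<lambda>i. vectorize m (s - 1) (\<lambda>is. T (i # is))) [0..<m])"

definition vec_concat :: "real vec list \<Rightarrow> real vec" where
  "vec_concat vs = foldr (@\<^sub>v) vs (0\<^sub>v 0)"

definition unfolding_matrix :: "nat \<Rightarrow> nat \<Rightarrow> nat mpoly \<Rightarrow> real mat" where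
  "unfolding_matrix m d p =
     mat_of_rows (delta m d)
       (map (\<lambda>i. vec_concat (map (\<lambda>s. row (unfolding1 m s (sym_tensors m d p)) i) [1..<d+1])) [0..<m])"

definition unfolding_tensor :: "nat \<Rightarrow> nat \<Rightarrow> nat \<Rightarrow> (nat \<Rightarrow> nat mpoly) \<Rightarrow> tensor3" where
  "unfolding_tensor m n d f =
     tensor3 n m (delta m d) (\<lambda>i j p. unfolding_matrix m d (f i) $$ (j, p))"

definition jacobian_tensor ::
  "nat \<Rightarrow> nat \<Rightarrow> nat \<Rightarrow> (nat \<Rightarrow> nat mpoly) \<Rightarrow> (nat \<Rightarrow> nat \<Rightarrow> real) \<Rightarrow> tensor3" where
  "jacobian_tensor m n N f u =
     tensor3 n m N (\<lambda>i j l. partial_deriv j (poly_eval (f i)) (u l))"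

definition kron :: "real vec \<Rightarrow> real vec \<Rightarrow> real vec" where
  "kron x y = vec (dim_vec x * dim_vec y) (\<lambda>i. x $ (i div dim_vec y) * y $ (i mod dim_vec y))"

fun kron_pow :: "real vec \<Rightarrow> nat \<Rightarrow> real vec" where
  "kron_pow x 0 = vec 1 (\<lambda>_. 1)"
| "kron_pow x (Suc k) = kron x (kron_pow x k)"

definition vandermonde_mat :: "nat \<Rightarrow> nat \<Rightarrow> nat \<Rightarrow> (nat \<Rightarrow> nat \<Rightarrow> real) \<Rightarrow> real mat" where
  "vandermonde_mat m d N u =
     mat_of_cols (delta m d)
       (map (\<lambda>j. vec_concat (map (\<lambda>k. real k \<cdot>\<^sub>v kron_pow (vec m (u j)) (k - 1)) [1..<d+1])) [0..<N])"

abbreviation mat_rank :: "real mat \<Rightarrow> nat" where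
  "mat_rank A \<equiv> vec_space.rank (dim_row A) A"

end

theory Submission
  imports Defs
begin

text \<open>
  The polynomials \<open>f i\<close> are governed by their symmetric coefficient tensors, which exist and are unique
  because monomials are linearly independent as functions. Symmetry lets one differentiate with respect
  to the first index only, at the price of the factor \<open>s\<close> in degree \<open>s\<close>; this is the identity
  \<open>J = Q \<bullet>\<^sub>3 A\<^sup>T\<close>.

  The row of \<open>A\<close> at a multi-index is a nonzero multiple of a row \<open>(T(u\<^sub>l))\<^sub>l\<close>, where \<open>T\<close> is the monomial
  (the multiset) underlying the multi-index. There are \<open>M\<close> such monomials, whence \<open>rank A \<le> M\<close>, and
  \<open>rank A = M\<close> as soon as the determinant \<open>det (T\<^sub>t(u\<^sub>s))\<close> of \<open>M\<close> points is nonzero. This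
  determinant vanishes on a Lebesgue null set: given points with nonzero determinant, the determinant
  of the next size is a nonzero polynomial in the new point, whose zeros form a null set by Fubini.

  If \<open>rank A = M\<close>, then \<open>A\<^sup>T\<close> is injective on vectors that are constant on multi-indices with the
  same monomial, so a matrix \<open>G\<close> recovers \<open>Q = J \<bullet>\<^sub>3 G\<close>. Hence CP decompositions transfer in both
  directions. In a minimal decomposition the matrices \<open>w\<^sub>k v\<^sub>k\<^sup>T\<close> are linearly independent, which
  forces \<open>h\<^sub>k = A\<^sup>T G h\<^sub>k\<close>.
\<close>

subsection \<open>Null sets of polynomials and determinants\<close>

text \<open>Fubini: the measure of the exceptional set is the integral of the measures of its
  sections in coordinate \<open>i\<close>, and almost all of these vanish.\<close>

lemma (in product_sigma_finite) AE_PiM_insert: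
  assumes "finite I" "i \<notin> I"
    and meas: "{x \<in> space (Pi\<^sub>M (insert i I) M). P x} \<in> sets (Pi\<^sub>M (insert i I) M)"
    and ae: "AE x in Pi\<^sub>M I M. AE y in M i. P (x(i := y))"
  shows "AE x in Pi\<^sub>M (insert i I) M. P x"
proof -
  let ?N = "{x \<in> space (Pi\<^sub>M (insert i I) M). \<not> P x}"
  have N: "?N \<in> sets (Pi\<^sub>M (insert i I) M)"
    using sets.compl_sets[OF meas] by (rule back_subst) auto
  have "emeasure (Pi\<^sub>M (insert i I) M) ?N = (\<integral>\<^sup>+ x. (\<integral>\<^sup>+ y. indicator ?N (x(i := y)) \<partial>M i) \<partial>Pi\<^sub>M I M)"
    using N assms(1,2) by (subst product_nn_integral_insert[symmetric]) auto
  also have "\<dots> = (\<integral>\<^sup>+ x. 0 \<partial>Pi\<^sub>M I M)"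
  proof (rule nn_integral_cong_AE, use ae in \<open>rule AE_mp\<close>, intro AE_I2 impI)
    fix x assume "AE y in M i. P (x(i := y))"
    then have "(\<integral>\<^sup>+ y. indicator ?N (x(i := y)) \<partial>M i) = (\<integral>\<^sup>+ y. 0 \<partial>M i)"
    proof (intro nn_integral_cong_AE, eventually_elim)
      case (elim y)
      then show ?case by simp
    qed
    then show "(\<integral>\<^sup>+ y. indicator ?N (x(i := y)) \<partial>M i) = 0" by simp
  qed
  finally have "emeasure (Pi\<^sub>M (insert i I) M) ?N = 0" by simp
  with N show ?thesis
    by (subst AE_iff_null) auto
qed

text \<open>Monomials are encoded as multisets of variables, so that multi-indices that are
  permutations of each other share one monomial, their \<open>mset\<close>.\<close>

definition monom_val :: "('v \<Rightarrow> real) \<Rightarrow> 'v multiset \<Rightarrow> real" where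
  "monom_val x T = (\<Prod>i\<in>#T. x i)"

lemma monom_val_simps [simp]:
  "monom_val x {#} = 1" "monom_val x (add_mset i T) = x i * monom_val x T"
  "monom_val x (S + T) = monom_val x S * monom_val x T"
  "monom_val x (replicate_mset k i) = x i ^ k"
  by (auto simp: monom_val_def)

lemma monom_val_mset: "monom_val x (mset is) = (\<Prod>i\<leftarrow>is. x i)"
  by (induction "is") auto

lemma monom_val_cong: "(\<And>i. i \<in># T \<Longrightarrow> x i = y i) \<Longrightarrow> monom_val x T = monom_val y T"
  unfolding monom_val_def by (metis image_mset_cong)

lemma monom_val_conv_prod:
  assumes "finite V" "set_mset T \<subseteq> V"
  shows "monom_val x T = (\<Prod>i\<in>V. x i ^ count T i)"
  unfolding monom_val_def image_prod_mset_multiplicity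
  using assms by (intro prod.mono_neutral_left) (auto simp: not_in_iff)

lemma measurable_monom_val:
  assumes "finite I" "set_mset T \<subseteq> I"
  shows "(\<lambda>x. monom_val x T) \<in> borel_measurable (Pi\<^sub>M I (\<lambda>_. lborel))"
  using assms(2) by (subst monom_val_conv_prod[OF assms]) measurable

text \<open>Induction on the number of variables: with the other coordinates fixed, the sum is a
  univariate polynomial in the last one. One of its coefficients is a nontrivial combination of
  monomials, hence nonzero almost everywhere, and a nonzero univariate polynomial has finitely many
  roots.\<close>

lemma AE_polynomial_nonzero:
  fixes m :: nat
  assumes "finite S" "\<And>T. T \<in> S \<Longrightarrow> set_mset T \<subseteq> {..<m}" "T0 \<in> S" "c T0 \<noteq> 0"
  shows "AE x in Pi\<^sub>M {..<m} (\<lambda>_. lborel). (\<Sum>T\<in>S. c T * monom_val x T) \<noteq> 0"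
  using assms
proof (induction m arbitrary: S T0 c)
  case 0
  then have "S = {{#}}" by auto
  with 0 show ?case by auto
next
  case (Suc m)
  interpret product_sigma_finite "\<lambda>_::nat. lborel :: real measure" by standard
  \<comment> \<open>The exponent of the last variable in \<open>T0\<close> selects the coefficient
    to be followed.\<close>
  define k where "k = count T0 m"
  define r where "r = (\<lambda>T::nat multiset. filter_mset (\<lambda>i. i \<noteq> m) T)"
  have split: "T = r T + replicate_mset (count T m) m" for T
    by (auto simp: r_def multiset_eq_iff)
  define S' where "S' = r ` {T \<in> S. count T m = k}"
  \<comment> \<open>Monomials with equal exponent of the last variable stay distinct when that
    variable is stripped, so nothing can cancel the term of \<open>T0\<close>.\<close>
  have inj: "inj_on r {T \<in> S. count T m = k}"
    by (rule inj_onI) (metis (mono_tags, lifting) mem_Collect_eq split)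
  have eval: "(\<Sum>T\<in>S. c T * monom_val (x(m := y)) T)
      = poly (\<Sum>T\<in>S. Polynomial.monom (c T * monom_val x (r T)) (count T m)) y" for x y
  proof -
    have "monom_val (x(m := y)) T = monom_val x (r T) * y ^ count T m" for T
      by (subst split[of T], subst monom_val_simps)
        (auto simp: r_def intro!: monom_val_cong)
    then show ?thesis by (simp add: poly_sum poly_monom mult_ac)
  qed
  have co: "coeff (\<Sum>T\<in>S. Polynomial.monom (c T * monom_val x (r T)) (count T m)) k
      = (\<Sum>T'\<in>S'. c (T' + replicate_mset k m) * monom_val x T')" for x
  proof -
    have "coeff (\<Sum>T\<in>S. Polynomial.monom (c T * monom_val x (r T)) (count T m)) k
      = (\<Sum>T\<in>{T \<in> S. count T m = k}. c T * monom_val x (r T))"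
      using Suc.prems(1) by (simp add: coeff_sum sum.inter_filter)
    also have "\<dots> = (\<Sum>T'\<in>S'. c (T' + replicate_mset k m) * monom_val x T')"
      unfolding S'_def by (subst sum.reindex[OF inj]) (auto intro!: sum.cong simp: split[symmetric])
    finally show ?thesis .
  qed
  have "AE x in Pi\<^sub>M {..<m} (\<lambda>_. lborel). (\<Sum>T'\<in>S'. c (T' + replicate_mset k m) * monom_val x T') \<noteq> 0"
  proof (rule Suc.IH)
    show "finite S'" using Suc.prems(1) by (simp add: S'_def)
    show "r T0 \<in> S'" using Suc.prems(3) by (auto simp: S'_def k_def)
    show "c (r T0 + replicate_mset k m) \<noteq> 0" using Suc.prems(4) split[of T0] by (simp add: k_def)
    show "set_mset T \<subseteq> {..<m}" if "T \<in> S'" for T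
      using that Suc.prems(2) by (fastforce simp: S'_def r_def less_Suc_eq)
  qed
  then have "AE x in Pi\<^sub>M {..<m} (\<lambda>_. lborel). AE y in lborel.
      (\<Sum>T\<in>S. c T * monom_val (x(m := y)) T) \<noteq> 0"
  proof eventually_elim
    case (elim x)
    let ?p = "\<Sum>T\<in>S. Polynomial.monom (c T * monom_val x (r T)) (count T m)"
    have "?p \<noteq> 0" using elim co[of x] by fastforce
    then have "finite {y. poly ?p y = 0}" by (rule poly_roots_finite)
    then have "{y. poly ?p y = 0} \<in> null_sets lborel" by (rule finite_imp_null_set_lborel)
    then show ?case
      unfolding eval by (rule AE_I') auto
  qed
  moreover
  have "(\<lambda>x. \<Sum>T\<in>S. c T * monom_val x T) \<in> borel_measurable (Pi\<^sub>M {..<Suc m} (\<lambda>_. lborel))"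
    using Suc.prems(2) by (intro borel_measurable_sum borel_measurable_times measurable_monom_val) auto
  then have "{x \<in> space (Pi\<^sub>M {..<Suc m} (\<lambda>_. lborel)). (\<Sum>T\<in>S. c T * monom_val x T) \<noteq> 0}
      \<in> sets (Pi\<^sub>M {..<Suc m} (\<lambda>_. lborel))"
    by measurable
  ultimately show ?case
    unfolding lessThan_Suc by (intro AE_PiM_insert) (simp only: finite_lessThan lessThan_iff less_irrefl not_False_eq_True)+
qed

lemma space_Pi_lborel: "space (Pi\<^sub>M {..<m} (\<lambda>_. lborel)) = R_pow m"
  by (simp add: space_PiM)

text \<open>In a product of nonzero total mass, a property that holds almost everywhere holds
  somewhere.\<close>

lemma emeasure_space_PiM_nonzero:
  assumes "sigma_finite_measure \<mu>" "emeasure \<mu> (space \<mu>) \<noteq> 0" "finite I"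
  shows "emeasure (Pi\<^sub>M I (\<lambda>_. \<mu>)) (space (Pi\<^sub>M I (\<lambda>_. \<mu>))) \<noteq> 0"
proof -
  interpret product_sigma_finite "\<lambda>_. \<mu>"
    using assms(1) by (simp add: product_sigma_finite_def)
  show ?thesis
    using assms(2,3) unfolding space_PiM by (subst emeasure_PiM) auto
qed

text \<open>A nontrivial combination would be nonzero almost everywhere, yet it is zero on all of
  \<open>R_pow m\<close>, which is not a null set.\<close>

lemma monom_val_linear_independent:
  fixes m :: nat
  assumes "finite S" "\<And>T. T \<in> S \<Longrightarrow> set_mset T \<subseteq> {..<m}"
    and zero: "\<And>x. x \<in> R_pow m \<Longrightarrow> (\<Sum>T\<in>S. c T * monom_val x T) = 0" and "T \<in> S"
  shows "c T = 0"
proof (rule ccontr)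
  assume "c T \<noteq> 0"
  then have "AE x in Pi\<^sub>M {..<m} (\<lambda>_. lborel). (\<Sum>T\<in>S. c T * monom_val x T) \<noteq> 0"
    by (intro AE_polynomial_nonzero[OF assms(1,2,4)])
  then have "AE x in Pi\<^sub>M {..<m} (\<lambda>_. lborel :: real measure). False"
    by (rule AE_mp[OF _ AE_I2]) (use zero in \<open>auto simp: space_Pi_lborel\<close>)
  then have "emeasure (Pi\<^sub>M {..<m} (\<lambda>_. lborel :: real measure)) (space (Pi\<^sub>M {..<m} (\<lambda>_. lborel :: real measure))) = 0"
    by (simp add: AE_iff_null null_setsD1)
  then show False
    using emeasure_space_PiM_nonzero[of "lborel :: real measure" "{..<m}"]
    by (simp add: lborel.sigma_finite_measure_axioms)
qed

section \<open>Determinants of functions evaluated at random points\<close>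

lemma permutes_less:
  "p permutes {0..<n} \<Longrightarrow> i < n \<Longrightarrow> p i < (n::nat)"
  using permutes_in_image[of p "{0..<n}" i] by simp

text \<open>By the Leibniz formula the determinant is a polynomial in its entries.\<close>

lemma measurable_det:
  assumes "\<And>s t. s < k \<Longrightarrow> t < k \<Longrightarrow> (\<lambda>x. f s t x) \<in> borel_measurable M"
  shows "(\<lambda>x. det (mat k k (\<lambda>(s, t). f s t x)) :: real) \<in> borel_measurable M"
proof -
  have "det (mat k k (\<lambda>(s, t). f s t x))
      = (\<Sum>p | p permutes {0..<k}. signof p * (\<Prod>i = 0..<k. f i (p i) x))" for x
    unfolding det_def by (auto intro!: sum.cong prod.cong simp: permutes_less)
  then show ?thesis
    using assms
    by (auto intro!: borel_measurable_sum borel_measurable_times borel_measurable_prod simp: permutes_less)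
qed

text \<open>Expanding along the last row, which holds the last point, the last coefficient is the
  determinant of the previous step, so that a.e. a nontrivial combination of the functions arises.\<close>

lemma AE_det_nonzero:
  fixes \<phi> :: "nat \<Rightarrow> 'a \<Rightarrow> real"
  assumes "sigma_finite_measure \<mu>"
    and meas: "\<And>t. t < n \<Longrightarrow> \<phi> t \<in> borel_measurable \<mu>"
    and comb: "\<And>c t. t < n \<Longrightarrow> c t \<noteq> 0 \<Longrightarrow> AE x in \<mu>. (\<Sum>t<n. c t * \<phi> t x) \<noteq> 0"
    and "k \<le> n"
  shows "AE x in Pi\<^sub>M {..<k} (\<lambda>_. \<mu>). det (mat k k (\<lambda>(s, t). \<phi> t (x s))) \<noteq> 0"
  using \<open>k \<le> n\<close>
proof (induction k)
  case 0
  show ?case by (simp add: det_def)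
next
  case (Suc k)
  interpret product_sigma_finite "\<lambda>_::nat. \<mu>"
    using assms(1) by (simp add: product_sigma_finite_def)
  \<comment> \<open>The cofactors of the last row: deleting column \<open>j\<close> shifts the later
    columns, and the new point does not occur.\<close>
  define C where "C = (\<lambda>x j. (-1) ^ (k + j) *
    det (mat k k (\<lambda>(s, t). \<phi> (if t < j then t else Suc t) (x s))))"
  have expand: "det (mat (Suc k) (Suc k) (\<lambda>(s, t). \<phi> t ((x(k := y)) s)))
      = (\<Sum>j<n. (if j \<le> k then C x j else 0) * \<phi> j y)" for x y
  proof -
    let ?A = "mat (Suc k) (Suc k) (\<lambda>(s, t). \<phi> t ((x(k := y)) s))"
    have "mat_delete ?A k j = mat k k (\<lambda>(s, t). \<phi> (if t < j then t else Suc t) (x s))"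
      if "j \<le> k" for j
      using that by (intro eq_matI) (auto simp: mat_delete_def)
    then have "cofactor ?A k j = C x j" if "j \<le> k" for j
      using that by (simp add: cofactor_def C_def)
    then have "det ?A = (\<Sum>j<Suc k. C x j * \<phi> j y)"
      by (subst laplace_expansion_row[of _ "Suc k" k]) (auto intro!: sum.cong simp: less_Suc_eq_le)
    \<comment> \<open>Zero coefficients pad the sum to all \<open>n\<close> functions, the form that
      \<open>comb\<close> expects.\<close>
    also have "\<dots> = (\<Sum>j<n. (if j \<le> k then C x j else 0) * \<phi> j y)"
      using Suc.prems by (intro sum.mono_neutral_cong_left) auto
    finally show ?thesis .
  qed
  have Ck: "C x k = det (mat k k (\<lambda>(s, t). \<phi> t (x s)))" for x
  proof -
    have "mat k k (\<lambda>(s, t). \<phi> (if t < k then t else Suc t) (x s)) = mat k k (\<lambda>(s, t). \<phi> t (x s))"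
      by (intro eq_matI) auto
    then show ?thesis by (simp add: C_def)
  qed
  have "AE x in Pi\<^sub>M {..<k} (\<lambda>_. \<mu>). det (mat k k (\<lambda>(s, t). \<phi> t (x s))) \<noteq> 0"
    using Suc by simp
  then have "AE x in Pi\<^sub>M {..<k} (\<lambda>_. \<mu>). AE y in \<mu>.
      det (mat (Suc k) (Suc k) (\<lambda>(s, t). \<phi> t ((x(k := y)) s))) \<noteq> 0"
    unfolding expand Ck[symmetric]
  proof eventually_elim
    case (elim x)
    then show ?case using Suc.prems by (intro comb[of k]) auto
  qed
  moreover
  have "(\<lambda>x. det (mat (Suc k) (Suc k) (\<lambda>(s, t). \<phi> t (x s))))
      \<in> borel_measurable (Pi\<^sub>M {..<Suc k} (\<lambda>_. \<mu>))"
    using meas Suc.prems by (intro measurable_det measurable_compose[OF measurable_component_singleton]) auto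
  then have "{x \<in> space (Pi\<^sub>M {..<Suc k} (\<lambda>_. \<mu>)). det (mat (Suc k) (Suc k) (\<lambda>(s, t). \<phi> t (x s))) \<noteq> 0}
      \<in> sets (Pi\<^sub>M {..<Suc k} (\<lambda>_. \<mu>))"
    by measurable
  ultimately show ?case
    unfolding lessThan_Suc by (intro AE_PiM_insert) (simp only: finite_lessThan lessThan_iff less_irrefl not_False_eq_True)+
qed


subsection \<open>Ranks of matrices with repeated rows\<close>

text \<open>Each \<open>t\<close> contributes a matrix of rank at most one, and the rank is
  subadditive.\<close>

lemma (in vec_space) rank_le_card_sum:
  assumes "finite F" "A \<in> carrier_mat n nc"
    and "\<And>p l. p < n \<Longrightarrow> l < nc \<Longrightarrow> A $$ (p, l) = (\<Sum>t\<in>F. c p t * \<phi> t l)"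
  shows "rank A \<le> card F"
  using assms
proof (induction F arbitrary: A rule: finite_induct)
  case empty
  then have "A = 0\<^sub>m n nc" by (intro eq_matI) auto
  then show ?case by (simp add: rank_0I)
next
  case (insert t F)
  let ?B = "mat n nc (\<lambda>(p, l). c p t * \<phi> t l)"
  let ?C = "mat n nc (\<lambda>(p, l). \<Sum>t\<in>F. c p t * \<phi> t l)"
  have "A = ?B + ?C"
    using insert by (intro eq_matI) auto
  then have "rank A \<le> rank ?B + rank ?C"
    using rank_subadditive[of ?B nc ?C] by simp
  also have "rank ?B \<le> 1"
    by (rule rank_le_1_product_entries[of _ nc "\<lambda>p. c p t" "\<phi> t"]) auto
  also have "rank ?C \<le> card F"
    by (rule insert.IH) auto
  finally show ?case using insert by simp
qed

text \<open>The rank is at least the size of any independent set of columns. As a set forgets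
  repetitions, the selected columns are first shown to be distinct.\<close>

lemma (in vec_space) rank_ge_if_columns_independent:
  assumes A: "A \<in> carrier_mat n nc" and \<sigma>: "\<And>j. j < k \<Longrightarrow> \<sigma> j < nc"
    and indep: "\<And>y j. (\<And>p. p < n \<Longrightarrow> (\<Sum>j<k. A $$ (p, \<sigma> j) * y j) = 0) \<Longrightarrow> j < k \<Longrightarrow> y j = 0"
  shows "k \<le> rank A"
proof -
  define B where "B = mat n k (\<lambda>(p, j). A $$ (p, \<sigma> j))"
  have B: "B \<in> carrier_mat n k" by (simp add: B_def)
  have dist: "distinct (cols B)"
  proof (subst distinct_conv_nth, intro allI impI notI)
    fix i j assume ij: "i < length (cols B)" "j < length (cols B)" "i \<noteq> j" "cols B ! i = cols B ! j"
    \<comment> \<open>Two equal columns would give the nontrivial relation column \<open>i\<close>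
      minus column \<open>j\<close>.\<close>
    define y where "y = (\<lambda>l. if l = i then 1 else if l = j then - 1 else 0 :: 'a)"
    have "y i = 0"
    proof (rule indep)
      show "i < k" using ij B by simp
      fix p assume p: "p < n"
      have "col B i = col B j" using ij by simp
      then have "B $$ (p, i) = B $$ (p, j)" using ij p B by (metis carrier_matD cols_length index_col)
      then have "A $$ (p, \<sigma> i) = A $$ (p, \<sigma> j)" using ij p by (simp add: B_def)
      moreover have "(\<Sum>l<k. A $$ (p, \<sigma> l) * y l)
        = (\<Sum>l<k. (if l = i then A $$ (p, \<sigma> i) else 0) - (if l = j then A $$ (p, \<sigma> j) else 0))"
        using ij by (intro sum.cong) (auto simp: y_def)
      ultimately show "(\<Sum>l<k. A $$ (p, \<sigma> l) * y l) = 0"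
        using ij B by (simp add: sum_subtractf)
    qed
    then show False by (simp add: y_def)
  qed
  have "lin_indpt (set (cols B))"
  proof
    assume "lin_dep (set (cols B))"
    then obtain v where v: "v \<in> carrier_vec k" "v \<noteq> 0\<^sub>v k" "B *\<^sub>v v = 0\<^sub>v n"
      using lin_depE[OF B _ dist] by blast
    have "v $ j = 0" if "j < k" for j
    proof (rule indep[OF _ that])
      fix p assume p: "p < n"
      have "(B *\<^sub>v v) $ p = 0" using v p by simp
      then show "(\<Sum>j<k. A $$ (p, \<sigma> j) * v $ j) = 0"
        using p v by (simp add: B_def scalar_prod_def lessThan_atLeast0)
    qed
    with v show False by (auto intro!: eq_vecI)
  qed
  moreover have "set (cols B) \<subseteq> set (cols A)"
  proof
    fix x assume "x \<in> set (cols B)"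
    then obtain j where j: "j < k" "x = col B j"
      using B by (auto simp: cols_def)
    then have "x = col A (\<sigma> j)"
      using A \<sigma> by (auto simp: B_def)
    then show "x \<in> set (cols A)"
      using j A \<sigma> by (auto simp: cols_def)
  qed
  ultimately have "card (set (cols B)) \<le> rank A"
    using rank_ge_card_indpt[OF A] by blast
  then show ?thesis
    using B distinct_card[OF dist] by simp
qed

text \<open>The dual family comes from inverting the Gram matrix.\<close>

lemma exists_dual_family:
  fixes \<phi> :: "nat \<Rightarrow> nat \<Rightarrow> real"
  assumes indep: "\<And>y t. (\<And>l. l < N \<Longrightarrow> (\<Sum>t<k. y t * \<phi> t l) = 0) \<Longrightarrow> t < k \<Longrightarrow> y t = 0"
  shows "\<exists>K. \<forall>t<k. \<forall>t'<k. (\<Sum>l<N. K t l * \<phi> t' l) = (if t = t' then 1 else 0)"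
proof -
  define P where "P = mat k N (\<lambda>(t, l). \<phi> t l)"
  have P: "P \<in> carrier_mat k N" by (simp add: P_def)
  let ?G = "P * transpose_mat P"
  have G: "?G \<in> carrier_mat k k" using P by simp
  have "det ?G \<noteq> 0"
  proof
    assume "det ?G = 0"
    then obtain v where v: "v \<in> carrier_vec k" "v \<noteq> 0\<^sub>v k" "?G *\<^sub>v v = 0\<^sub>v k"
      using det_0_iff_vec_prod_zero_field[OF G] by blast
    let ?w = "transpose_mat P *\<^sub>v v"
    have w: "?w \<in> carrier_vec N" using P by (intro carrier_vecI) simp
    have "P *\<^sub>v ?w = 0\<^sub>v k" using v P by (simp add: assoc_mult_mat_vec[of _ k N _ k])
    then have "v \<bullet> (P *\<^sub>v ?w) = 0" using v by simp
    \<comment> \<open>A kernel vector \<open>v\<close> of the Gram matrix thus makes the squared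
      length of \<open>?w\<close> vanish, and \<open>?w = 0\<close> is a relation among the rows of
      \<open>P\<close>.\<close>
    then have "?w \<bullet> ?w = 0"
      using transpose_vec_mult_scalar[OF P w v(1)] by simp
    then have "(\<Sum>l<N. ?w $ l * ?w $ l) = 0"
      unfolding scalar_prod_def carrier_vecD[OF w] lessThan_atLeast0 .
    then have w0: "?w $ l = 0" if "l < N" for l
      using that by (subst (asm) sum_nonneg_eq_0_iff) auto
    have "v $ t = 0" if "t < k" for t
    proof (rule indep[OF _ that])
      fix l assume "l < N"
      then show "(\<Sum>t<k. v $ t * \<phi> t l) = 0"
        using w0[of l] v P by (simp add: P_def scalar_prod_def lessThan_atLeast0 mult.commute)
    qed
    with v show False by (auto intro!: eq_vecI)
  qed
  then obtain B where B: "B \<in> carrier_mat k k" "B * ?G = 1\<^sub>m k"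
    using det_non_zero_imp_unit[OF G] by (auto simp: Units_def ring_mat_def)
  define K where "K = B * P"
  have KP: "K * transpose_mat P = 1\<^sub>m k"
    using B P by (simp add: K_def assoc_mult_mat[of _ k k _ N _ k])
  have K: "K \<in> carrier_mat k N" using B P by (simp add: K_def)
  have "(\<Sum>l<N. K $$ (t, l) * \<phi> t' l) = (if t = t' then 1 else 0)" if t: "t < k" "t' < k" for t t'
  proof -
    have "(K * transpose_mat P) $$ (t, t') = (\<Sum>l<N. K $$ (t, l) * \<phi> t' l)"
      using t K P by (simp add: P_def scalar_prod_def lessThan_atLeast0)
    then show ?thesis using t by (simp add: KP)
  qed
  then show ?thesis by (intro exI[of _ "\<lambda>t l. K $$ (t, l)"]) simp
qed

lemma dual_family_indexed:
  fixes \<phi> :: "'t \<Rightarrow> nat \<Rightarrow> real"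
  assumes "finite F"
    and indep: "\<And>y t. (\<And>l. l < N \<Longrightarrow> (\<Sum>t\<in>F. y t * \<phi> t l) = 0) \<Longrightarrow> t \<in> F \<Longrightarrow> y t = 0"
  obtains K where "\<And>t t'. t \<in> F \<Longrightarrow> t' \<in> F \<Longrightarrow> (\<Sum>l<N. K t l * \<phi> t' l) = (if t = t' then 1 else 0)"
proof -
  obtain \<tau> where \<tau>: "bij_betw \<tau> {..<card F} F"
    using \<open>finite F\<close> ex_bij_betw_nat_finite lessThan_atLeast0 by metis
  define \<rho> where "\<rho> = the_inv_into {..<card F} \<tau>"
  have \<rho>: "\<rho> t < card F" "\<tau> (\<rho> t) = t" if "t \<in> F" for t
    using bij_betw_the_inv_into[OF \<tau>] that \<tau>
    by (auto simp: \<rho>_def bij_betw_def f_the_inv_into_f)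
  have \<rho>\<tau>: "\<rho> (\<tau> i) = i" if "i < card F" for i
    using that \<tau> by (simp add: \<rho>_def bij_betw_def the_inv_into_f_f)
  have "\<exists>K. \<forall>t<card F. \<forall>t'<card F. (\<Sum>l<N. K t l * \<phi> (\<tau> t') l) = (if t = t' then 1 else 0)"
  proof (rule exists_dual_family)
    fix y t assume y: "\<And>l. l < N \<Longrightarrow> (\<Sum>t<card F. y t * \<phi> (\<tau> t) l) = 0" and t: "t < card F"
    have "(y \<circ> \<rho>) (\<tau> t) = 0"
    proof (rule indep)
      show "\<tau> t \<in> F" using t \<tau> by (auto simp: bij_betw_def)
      fix l assume "l < N"
      then show "(\<Sum>t\<in>F. (y \<circ> \<rho>) t * \<phi> t l) = 0"
        using y[of l] by (simp add: sum.reindex_bij_betw[OF \<tau>, symmetric] \<rho>\<tau>)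
    qed
    then show "y t = 0" using t by (simp add: \<rho>\<tau>)
  qed
  then obtain K where K: "\<And>t t'. t < card F \<Longrightarrow> t' < card F \<Longrightarrow>
      (\<Sum>l<N. K t l * \<phi> (\<tau> t') l) = (if t = t' then 1 else 0)" by blast
  show ?thesis
  proof
    fix t t' assume "t \<in> F" "t' \<in> F"
    then show "(\<Sum>l<N. K (\<rho> t) l * \<phi> t' l) = (if t = t' then 1 else 0)"
      using K[of "\<rho> t" "\<rho> t'"] \<rho>[of t] \<rho>[of t'] by (metis)
  qed
qed

text \<open>The pattern of the Vandermonde-like matrix: \<open>g p\<close> is the monomial of the
  multi-index at row \<open>p\<close>, \<open>w p\<close> is the degree factor of its block, and
  \<open>\<phi> t l\<close> is the value of the monomial \<open>t\<close> at point
  \<open>l\<close>.\<close>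

locale repeated_rows =
  fixes A :: "real mat" and D N :: nat and F :: "'t set"
    and w :: "nat \<Rightarrow> real" and g :: "nat \<Rightarrow> 't" and \<phi> :: "'t \<Rightarrow> nat \<Rightarrow> real"
  assumes finite_F: "finite F" and A: "A \<in> carrier_mat D N"
    and entry: "p < D \<Longrightarrow> l < N \<Longrightarrow> A $$ (p, l) = w p * \<phi> (g p) l"
    and g: "p < D \<Longrightarrow> g p \<in> F" and surj: "t \<in> F \<Longrightarrow> \<exists>p<D. g p = t"
    and w: "p < D \<Longrightarrow> w p \<noteq> 0"
begin

text \<open>Every row is a multiple of some \<open>\<phi> t\<close>, so \<open>A\<close> is a sum of
  \<open>card F\<close> matrices of rank at most one.\<close>

lemma rank_le: "mat_rank A \<le> card F"
proof -
  interpret vec_space "TYPE(real)" D .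
  have "rank A \<le> card F"
  proof (rule rank_le_card_sum[OF finite_F A])
    fix p l assume "p < D" "l < N"
    have "(\<Sum>t\<in>F. (if t = g p then w p else 0) * \<phi> t l) = (\<Sum>t\<in>F. if t = g p then w p * \<phi> t l else 0)"
      by (intro sum.cong) auto
    then show "A $$ (p, l) = (\<Sum>t\<in>F. (if t = g p then w p else 0) * \<phi> t l)"
      using \<open>p < D\<close> \<open>l < N\<close> finite_F g by (simp add: entry)
  qed
  then show ?thesis using A by simp
qed

text \<open>A relation among the rows would express \<open>A\<close> as a sum of \<open>card F - 1\<close> rank-one matrices.\<close>

lemma full_rank_imp_independent:
  assumes "mat_rank A = card F" "\<And>l. l < N \<Longrightarrow> (\<Sum>t\<in>F. y t * \<phi> t l) = 0" "t0 \<in> F"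
  shows "y t0 = 0"
proof (rule ccontr)
  assume y0: "y t0 \<noteq> 0"
  interpret vec_space "TYPE(real)" D .
  have "rank A \<le> card (F - {t0})"
  proof (rule rank_le_card_sum[OF _ A])
    show "finite (F - {t0})" using finite_F by simp
    fix p l assume pl: "p < D" "l < N"
    \<comment> \<open>Rows with \<open>g p = t0\<close> are rewritten by solving the relation for
      \<open>\<phi> t0\<close>; all other rows keep their single term.\<close>
    let ?c = "\<lambda>t. (if t = g p then w p else 0) - (if g p = t0 then w p * y t / y t0 else 0)"
    have "y t0 * \<phi> t0 l + (\<Sum>t\<in>F - {t0}. y t * \<phi> t l) = 0"
      using assms(2)[OF pl(2)] sum.remove[OF finite_F assms(3), of "\<lambda>t. y t * \<phi> t l"] by simp
    then have t0: "\<phi> t0 l = - (\<Sum>t\<in>F - {t0}. y t * \<phi> t l) / y t0"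
      using y0 by (simp add: field_simps)
    have "(\<Sum>t\<in>F - {t0}. ?c t * \<phi> t l)
      = (\<Sum>t\<in>F - {t0}. if t = g p then w p * \<phi> t l else 0)
        - (if g p = t0 then w p / y t0 else 0) * (\<Sum>t\<in>F - {t0}. y t * \<phi> t l)"
      by (simp add: left_diff_distrib sum_subtractf sum_distrib_left)
        (auto intro!: sum.cong split: if_splits)
    also have "\<dots> = w p * \<phi> (g p) l"
      using finite_F g[OF pl(1)] t0 by auto
    finally show "A $$ (p, l) = (\<Sum>t\<in>F - {t0}. ?c t * \<phi> t l)"
      using pl by (simp add: entry)
  qed
  moreover have "card (F - {t0}) < card F"
    using finite_F assms(3) by (rule card_Diff1_less)
  ultimately show False using assms(1) A by simp
qed

text \<open>A relation among the columns \<open>\<sigma> j\<close>, divided by the nonzero weights,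
  says that the transpose of the given matrix annihilates \<open>y\<close>, so \<open>y = 0\<close>.
  This is the lower bound; \<open>rank_le\<close> gives the upper one.\<close>

lemma full_rank_if_det_nonzero:
  assumes \<tau>: "bij_betw \<tau> {..<k} F" and \<sigma>: "\<And>s. s < k \<Longrightarrow> \<sigma> s < N"
    and det: "det (mat k k (\<lambda>(s, t). \<phi> (\<tau> t) (\<sigma> s))) \<noteq> 0"
  shows "mat_rank A = k"
proof -
  interpret vec_space "TYPE(real)" D .
  let ?B = "transpose_mat (mat k k (\<lambda>(s, t). \<phi> (\<tau> t) (\<sigma> s)))"
  have "k \<le> rank A"
  proof (rule rank_ge_if_columns_independent[OF A \<sigma>])
    fix y j assume y: "\<And>p. p < D \<Longrightarrow> (\<Sum>j<k. A $$ (p, \<sigma> j) * y j) = 0" and j: "j < k"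
    have "?B *\<^sub>v vec k y = 0\<^sub>v k"
    proof (rule eq_vecI)
      fix t assume "t < dim_vec (0\<^sub>v k)"
      then have t: "t < k" by simp
      then have "\<tau> t \<in> F" using \<tau> by (auto simp: bij_betw_def)
      then obtain p where p: "p < D" "g p = \<tau> t" using surj by blast
      have "w p * (\<Sum>j<k. \<phi> (\<tau> t) (\<sigma> j) * y j) = (\<Sum>j<k. A $$ (p, \<sigma> j) * y j)"
        using p \<sigma> by (simp add: entry sum_distrib_left mult.assoc)
      then have "(\<Sum>j<k. \<phi> (\<tau> t) (\<sigma> j) * y j) = 0"
        using y[OF p(1)] w[OF p(1)] by simp
      then show "(?B *\<^sub>v vec k y) $ t = 0\<^sub>v k $ t"
        using t by (simp add: scalar_prod_def lessThan_atLeast0)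
    qed simp
    moreover have "det ?B \<noteq> 0" using det by (subst det_transpose) auto
    ultimately have "vec k y = 0\<^sub>v k"
      using det_0_iff_vec_prod_zero_field[of ?B k] vec_carrier[of k y]
        transpose_carrier_mat[of _ k k] mat_carrier by blast
    then show "y j = 0" using j by (metis index_vec index_zero_vec(1))
  qed
  moreover have "card F = k" using bij_betw_same_card[OF \<tau>] by simp
  ultimately show ?thesis using rank_le A by simp
qed

text \<open>Full rank makes the rows \<open>\<phi> t\<close> independent, so they have a dual
  family. It reads off from the transpose of \<open>A\<close> applied to \<open>z\<close> the sum of
  \<open>w q * z q\<close> over the fibre of \<open>g p\<close>, which is the size of the fibre
  times \<open>w p * z p\<close>.\<close>

lemma left_inverse_on_constant_fibres:
  assumes "mat_rank A = card F"
  shows "\<exists>G. \<forall>z. (\<forall>p<D. \<forall>q<D. g p = g q \<longrightarrow> w p * z p = w q * z q) \<longrightarrow>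
    (\<forall>p<D. (\<Sum>l<N. G p l * (\<Sum>q<D. A $$ (q, l) * z q)) = z p)"
proof -
  obtain K where K: "\<And>t t'. t \<in> F \<Longrightarrow> t' \<in> F \<Longrightarrow> (\<Sum>l<N. K t l * \<phi> t' l) = (if t = t' then 1 else 0)"
    using full_rank_imp_independent[OF assms] by (rule dual_family_indexed[OF finite_F, of N \<phi>]) auto
  define fib where "fib = (\<lambda>p. {q \<in> {..<D}. g q = g p})"
  show ?thesis
  proof (intro exI allI impI)
    fix z :: "nat \<Rightarrow> real" and p
    assume z: "\<forall>p<D. \<forall>q<D. g p = g q \<longrightarrow> w p * z p = w q * z q" and p: "p < D"
    have "(\<Sum>l<N. K (g p) l * (\<Sum>q<D. A $$ (q, l) * z q))
      = (\<Sum>l<N. \<Sum>q<D. w q * z q * (K (g p) l * \<phi> (g q) l))"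
      by (simp add: entry sum_distrib_left mult_ac)
    also have "\<dots> = (\<Sum>q<D. w q * z q * (\<Sum>l<N. K (g p) l * \<phi> (g q) l))"
      by (subst sum.swap) (simp add: sum_distrib_left)
    also have "\<dots> = (\<Sum>q<D. if g q = g p then w q * z q else 0)"
      using p K g by (intro sum.cong) simp_all
    also have "\<dots> = (\<Sum>q\<in>fib p. w q * z q)"
      unfolding fib_def by (subst sum.inter_filter) auto
    also have "\<dots> = card (fib p) * (w p * z p)"
    proof -
      have "w q * z q = w p * z p" if "q \<in> fib p" for q
        using that p z[rule_format, of q p] by (simp add: fib_def)
      then have "(\<Sum>q\<in>fib p. w q * z q) = (\<Sum>q\<in>fib p. w p * z p)" by (rule sum.cong[OF refl])
      then show ?thesis by simp
    qed
    finally have "(\<Sum>l<N. K (g p) l * (\<Sum>q<D. A $$ (q, l) * z q)) = card (fib p) * (w p * z p)" .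
    moreover have "card (fib p) > 0" using p by (auto simp: fib_def card_gt_0_iff)
    ultimately show "(\<Sum>l<N. K (g p) l / (card (fib p) * w p) * (\<Sum>q<D. A $$ (q, l) * z q)) = z p"
      using w[OF p] by (simp add: sum_divide_distrib[symmetric] divide_simps)
  qed
qed

end


subsection \<open>Symmetric coefficient tensors and partial derivatives\<close>

lemma multi_indices_0 [simp]: "multi_indices m 0 = {[]}"
  by (auto simp: multi_indices_def)

lemma multi_indices_Suc:
  "multi_indices m (Suc s) = (\<lambda>(a, as). a # as) ` ({..<m} \<times> multi_indices m s)"
  by (auto simp: multi_indices_def length_Suc_conv image_iff)

lemma finite_multi_indices [simp]: "finite (multi_indices m s)"
  by (induction s) (auto simp: multi_indices_Suc)

lemma sum_multi_indices_Suc: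
  "(\<Sum>is\<in>multi_indices m (Suc s). f is) = (\<Sum>a<m. \<Sum>as\<in>multi_indices m s. f (a # as))"
  unfolding multi_indices_Suc
  by (subst sum.reindex) (auto simp: inj_on_def sum.cartesian_product case_prod_unfold)

lemma mset_in_multisets_of_size_iff:
  "mset is \<in> multisets_of_size {..<m} s \<longleftrightarrow> is \<in> multi_indices m s"
  by (auto simp: multisets_of_size_def multi_indices_def)

text \<open>The product rule for the derivative of a monomial with respect to variable
  \<open>j\<close>; recursion on the first factor suits induction on the order of the
  tensor.\<close>

primrec deriv_prod :: "('v \<Rightarrow> real) \<Rightarrow> 'v \<Rightarrow> 'v list \<Rightarrow> real" where
  "deriv_prod x j [] = 0"
| "deriv_prod x j (a # as) = (if a = j then \<Prod>i\<leftarrow>as. x i else 0) + x a * deriv_prod x j as"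

lemma has_derivative_prod:
  "((\<lambda>t. \<Prod>i\<leftarrow>is. (x(j := t)) i) has_real_derivative deriv_prod x j is) (at (x j))"
proof (induction "is")
  case (Cons a "is")
  have "((\<lambda>t. (x(j := t)) a) has_real_derivative (if a = j then 1 else 0)) (at (x j))"
    by (cases "a = j") auto
  from DERIV_mult[OF this Cons] have "((\<lambda>t. \<Prod>i\<leftarrow>a # is. (x(j := t)) i) has_real_derivative
      (if a = j then 1 else 0) * (\<Prod>i\<leftarrow>is. (x(j := x j)) i) + deriv_prod x j is * (x(j := x j)) a) (at (x j))"
    by simp
  then show ?case
    unfolding fun_upd_triv by (rule back_subst) (simp add: mult.commute)
qed simp

text \<open>By symmetry each position that the derivative can hit contributes as much as the first.
  In the induction step the product rule on the first index gives one copy, and the induction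
  hypothesis for the slices gives the others.\<close>

lemma sum_symmetric_deriv_prod:
  fixes \<Psi> :: "nat list \<Rightarrow> real"
  assumes "j < m"
    and "\<And>is js. is \<in> multi_indices m (Suc s) \<Longrightarrow> mset is = mset js \<Longrightarrow> \<Psi> is = \<Psi> js"
  shows "(\<Sum>is\<in>multi_indices m (Suc s). \<Psi> is * deriv_prod x j is)
    = Suc s * (\<Sum>js\<in>multi_indices m s. \<Psi> (j # js) * (\<Prod>i\<leftarrow>js. x i))"
  using assms(2)
proof (induction s arbitrary: \<Psi>)
  case 0
  have "(\<Sum>a<m. \<Psi> [a] * deriv_prod x j [a]) = (\<Sum>a<m. if a = j then \<Psi> [j] else 0)"
    by (intro sum.cong) auto
  then show ?case using \<open>j < m\<close> by (simp add: sum_multi_indices_Suc del: deriv_prod.simps)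
next
  case (Suc s)
  have "(\<Sum>is\<in>multi_indices m (Suc (Suc s)). \<Psi> is * deriv_prod x j is)
    = (\<Sum>a<m. if a = j then \<Sum>as\<in>multi_indices m (Suc s). \<Psi> (a # as) * (\<Prod>i\<leftarrow>as. x i) else 0)
      + (\<Sum>a<m. x a * (\<Sum>as\<in>multi_indices m (Suc s). \<Psi> (a # as) * deriv_prod x j as))"
    unfolding sum_multi_indices_Suc[of _ _ "Suc s"] sum.distrib[symmetric] sum_distrib_left
    by (intro sum.cong) (auto simp: algebra_simps sum.distrib)
  also have "(\<Sum>a<m. x a * (\<Sum>as\<in>multi_indices m (Suc s). \<Psi> (a # as) * deriv_prod x j as))
    = (\<Sum>a<m. x a * (Suc s * (\<Sum>as\<in>multi_indices m s. \<Psi> (j # a # as) * (\<Prod>i\<leftarrow>as. x i))))"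
  proof (intro sum.cong refl arg_cong2[of _ _ _ _ "(*)"])
    fix a assume a: "a \<in> {..<m}"
    have "(\<Sum>as\<in>multi_indices m (Suc s). \<Psi> (a # as) * deriv_prod x j as)
      = Suc s * (\<Sum>as\<in>multi_indices m s. \<Psi> (a # j # as) * (\<Prod>i\<leftarrow>as. x i))"
      using a by (intro Suc.IH Suc.prems) (auto simp: multi_indices_Suc[of m "Suc s"])
    \<comment> \<open>Symmetry exchanges \<open>a\<close> and \<open>j\<close>, which brings
      \<open>j\<close> to the front.\<close>
    also have "(\<Sum>as\<in>multi_indices m s. \<Psi> (a # j # as) * (\<Prod>i\<leftarrow>as. x i))
      = (\<Sum>as\<in>multi_indices m s. \<Psi> (j # a # as) * (\<Prod>i\<leftarrow>as. x i))"
      using a \<open>j < m\<close>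
      by (intro sum.cong refl arg_cong2[of _ _ _ _ "(*)"] Suc.prems) (auto simp: multi_indices_Suc)
    finally show "(\<Sum>as\<in>multi_indices m (Suc s). \<Psi> (a # as) * deriv_prod x j as)
      = Suc s * (\<Sum>as\<in>multi_indices m s. \<Psi> (j # a # as) * (\<Prod>i\<leftarrow>as. x i))" .
  qed
  also have "\<dots> = Suc s * (\<Sum>js\<in>multi_indices m (Suc s). \<Psi> (j # js) * (\<Prod>i\<leftarrow>js. x i))"
    by (simp add: sum_multi_indices_Suc sum_distrib_left mult_ac)
  finally show ?case
    using \<open>j < m\<close> by (simp add: algebra_simps)
qed

section \<open>Polynomials as combinations of monomials\<close>

definition exponents :: "'v multiset \<Rightarrow> 'v \<Rightarrow>\<^sub>0 nat" where
  "exponents T = Abs_poly_mapping (count T)"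

lemma lookup_exponents [simp]: "lookup (exponents T) = count T"
  unfolding exponents_def by (rule lookup_Abs_poly_mapping) simp

lemma keys_exponents [simp]: "keys (exponents T) = set_mset T"
  by (auto simp: Poly_Mapping.in_keys_iff)

lemma inj_exponents: "inj exponents"
  by (rule injI) (metis lookup_exponents multiset_eqI)

lemma exponents_surj: "\<exists>T. exponents T = t"
proof -
  have "count (Abs_multiset (lookup t)) = lookup t"
    using finite_lookup[of t] by (intro count_Abs_multiset) simp
  then have "exponents (Abs_multiset (lookup t)) = t"
    by (simp add: exponents_def)
  then show ?thesis ..
qed

lemma poly_eval_conv_sum:
  assumes "finite S" "keys p \<subseteq> exponents ` S"
  shows "poly_eval p x = (\<Sum>T\<in>S. lookup p (exponents T) * monom_val x T)"
proof -
  have "poly_eval p x = (\<Sum>t\<in>exponents ` S. lookup p t * (\<Prod>v\<in>keys t. x v ^ lookup t v))"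
    unfolding poly_eval_def using assms
    by (intro sum.mono_neutral_left) (auto simp: Poly_Mapping.in_keys_iff)
  also have "\<dots> = (\<Sum>T\<in>S. lookup p (exponents T) * monom_val x T)"
    by (subst sum.reindex)
      (auto intro: inj_on_subset[OF inj_exponents] simp: monom_val_def image_prod_mset_multiplicity)
  finally show ?thesis .
qed

text \<open>Degree 0 is left out because there is no constant term; the union over degrees matches
  the orders of the tensors.\<close>

definition monoms :: "nat \<Rightarrow> nat \<Rightarrow> nat multiset set" where
  "monoms m d = (\<Union>s\<in>{1..d}. multisets_of_size {..<m} s)"

lemma finite_monoms [simp]: "finite (monoms m d)"
  by (auto simp: monoms_def)

lemma poly_eval_poly_space:
  assumes "p \<in> poly_space m d"
  shows "poly_eval p x = (\<Sum>T\<in>monoms m d. lookup p (exponents T) * monom_val x T)"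
proof (rule poly_eval_conv_sum)
  show "keys p \<subseteq> exponents ` monoms m d"
  proof
    fix t assume t: "t \<in> keys p"
    obtain T where T: "t = exponents T" using exponents_surj by metis
    have "(\<forall>t\<in>keys p. keys t \<subseteq> {..<m} \<and> monom_deg t \<le> d) \<and> lookup p 0 = 0"
      using assms by (simp add: poly_space_def polys_in_def)
    then have "keys (exponents T) \<subseteq> {..<m}" "monom_deg (exponents T) \<le> d" "exponents T \<noteq> 0"
      using t unfolding T by (fast, fast, auto simp: Poly_Mapping.in_keys_iff)
    then have "set_mset T \<subseteq> {..<m}" "size T \<le> d" "exponents T \<noteq> 0"
      by (auto simp: monom_deg_def size_multiset_overloaded_eq)
    \<comment> \<open>The empty multiset is the constant monomial, whose coefficient is zero in
      \<open>poly_space\<close>.\<close>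
    moreover have "exponents {#} = (0 :: 'b \<Rightarrow>\<^sub>0 nat)" by (simp add: poly_mapping_eqI)
    ultimately have "T \<in> monoms m d"
      by (cases "T = {#}") (auto simp: monoms_def multisets_of_size_def Suc_le_eq nonempty_has_size)
    then show "t \<in> exponents ` monoms m d" using T by simp
  qed
qed simp

text \<open>All arrangements of a multiset \<open>T\<close> as a list give the same monomial, so its
  coefficient is the sum of the tensor entries over them.\<close>

lemma sum_over_multi_indices:
  "(\<Sum>s=1..d. \<Sum>is\<in>multi_indices m s. \<Psi> is * (\<Prod>i\<leftarrow>is. x i))
    = (\<Sum>T\<in>monoms m d. (\<Sum>is | mset is = T. \<Psi> is) * monom_val x T)"
proof -
  have "(\<Sum>is\<in>multi_indices m s. \<Psi> is * (\<Prod>i\<leftarrow>is. x i))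
      = (\<Sum>T\<in>multisets_of_size {..<m} s. (\<Sum>is | mset is = T. \<Psi> is) * monom_val x T)" for s
  proof -
    have "(\<Sum>is\<in>multi_indices m s. \<Psi> is * (\<Prod>i\<leftarrow>is. x i))
      = (\<Sum>T\<in>multisets_of_size {..<m} s. \<Sum>is\<in>{is \<in> multi_indices m s. mset is = T}. \<Psi> is * (\<Prod>i\<leftarrow>is. x i))"
      by (rule sum.group[symmetric]) (auto simp: mset_in_multisets_of_size_iff)
    also have "\<dots> = (\<Sum>T\<in>multisets_of_size {..<m} s. (\<Sum>is | mset is = T. \<Psi> is) * monom_val x T)"
      unfolding sum_distrib_right
      by (intro sum.cong) (auto simp: mset_in_multisets_of_size_iff monom_val_mset)
    finally show ?thesis .
  qed
  then show ?thesis
    unfolding monoms_def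
    by (subst sum.UNION_disjoint) (auto simp: finite_multisets_of_size dest!: multisets_of_size_size)
qed

text \<open>Existence: each coefficient is spread evenly over the arrangements of its monomial.
  Uniqueness: linear independence of monomials determines the sum over the arrangements, and by
  symmetry this sum is a positive multiple of each single entry.\<close>

lemma ex1_represents_poly:
  assumes p: "p \<in> poly_space m d"
  shows "\<exists>!\<Psi>. represents_poly m d p \<Psi>"
proof (rule ex_ex1I)
  let ?U = "\<Union>s\<in>{1..d}. multi_indices m s"
  have U: "is \<in> ?U \<longleftrightarrow> mset is \<in> monoms m d" for "is"
    by (auto simp: monoms_def mset_in_multisets_of_size_iff)
  \<comment> \<open>A multiset has at least one and only finitely many arrangements, so their number
    may be divided by.\<close>
  have pos: "card {is. mset is = T} > 0" for T :: "nat multiset"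
    proof -
    obtain ts where ts: "mset ts = T" using ex_mset by blast
    then show ?thesis using mset_eq_finite[of ts] by (auto simp: card_gt_0_iff)
  qed
  define \<Psi> where "\<Psi> = restrict (\<lambda>is. lookup p (exponents (mset is)) / card {js. mset js = mset is}) ?U"
  have "(\<Sum>is | mset is = T. \<Psi> is) = lookup p (exponents T)" if "T \<in> monoms m d" for T
  proof -
    have "(\<Sum>is | mset is = T. \<Psi> is) = (\<Sum>is | mset is = T. lookup p (exponents T) / card {js. mset js = T})"
      using that U by (intro sum.cong) (auto simp: \<Psi>_def)
    then show ?thesis using pos[of T] by simp
  qed
  then have "represents_poly m d p \<Psi>"
    unfolding represents_poly_def sum_over_multi_indices
    by (auto simp: poly_eval_poly_space[OF p] \<Psi>_def)
  then show "\<exists>\<Psi>. represents_poly m d p \<Psi>" by blast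
  fix \<Psi> \<Psi>' assume r: "represents_poly m d p \<Psi>" "represents_poly m d p \<Psi>'"
  have eq: "(\<Sum>is | mset is = T. \<Psi> is) - (\<Sum>is | mset is = T. \<Psi>' is) = 0" if "T \<in> monoms m d" for T
  proof (rule monom_val_linear_independent[OF finite_monoms _ _ that, of m])
    show "set_mset T \<subseteq> {..<m}" if "T \<in> monoms m d" for T
      using that by (auto simp: monoms_def multisets_of_size_def)
    show "(\<Sum>T\<in>monoms m d. ((\<Sum>is | mset is = T. \<Psi> is) - (\<Sum>is | mset is = T. \<Psi>' is)) * monom_val x T) = 0"
      if "x \<in> R_pow m" for x
    proof -
      have "poly_eval p x = (\<Sum>T\<in>monoms m d. (\<Sum>is | mset is = T. \<Psi> is) * monom_val x T)"
        "poly_eval p x = (\<Sum>T\<in>monoms m d. (\<Sum>is | mset is = T. \<Psi>' is) * monom_val x T)"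
        using r that unfolding represents_poly_def sum_over_multi_indices by blast+
      then show ?thesis
        unfolding left_diff_distrib sum_subtractf by simp
    qed
  qed
  have sum: "(\<Sum>js | mset js = mset is. \<Phi> js) = card {js. mset js = mset is} * \<Phi> is"
    if "represents_poly m d p \<Phi>" "is \<in> ?U" for \<Phi> :: "nat list \<Rightarrow> real" and "is"
  proof -
    have "\<Phi> js = \<Phi> is" if "mset js = mset is" for js
    proof -
      obtain s where s: "s \<in> {1..d}" "is \<in> multi_indices m s" using \<open>is \<in> ?U\<close> by blast
      then have "js \<in> multi_indices m s" using that by (metis mset_in_multisets_of_size_iff)
      then show ?thesis using \<open>represents_poly m d p \<Phi>\<close> s that unfolding represents_poly_def by blast
    qed
    then have "(\<Sum>js | mset js = mset is. \<Phi> js) = (\<Sum>js | mset js = mset is. \<Phi> is)"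
      using sum.cong[OF refl, of "{js. mset js = mset is}" \<Phi> "\<lambda>_. \<Phi> is"] by blast
    then show ?thesis by simp
  qed
  show "\<Psi> = \<Psi>'"
  proof (rule extensionalityI)
    show "\<Psi> \<in> extensional ?U" "\<Psi>' \<in> extensional ?U"
      using r unfolding represents_poly_def by blast+
    fix "is" assume isU: "is \<in> ?U"
    have "card {js. mset js = mset is} * \<Psi> is = card {js. mset js = mset is} * \<Psi>' is"
      using eq[OF U[THEN iffD1, OF isU]] unfolding sum[OF r(1) isU] sum[OF r(2) isU] by (rule right_minus_eq[THEN iffD1])
    then show "\<Psi> is = \<Psi>' is"
      using pos[of "mset is"] by simp
  qed
qed

lemma represents_sym_tensors:
  "p \<in> poly_space m d \<Longrightarrow> represents_poly m d p (sym_tensors m d p)"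
  unfolding sym_tensors_def by (rule theI'[OF ex1_represents_poly])

lemma sym_tensors_symmetric:
  assumes "p \<in> poly_space m d" "s \<in> {1..d}" "is \<in> multi_indices m s" "mset is = mset js"
  shows "sym_tensors m d p is = sym_tensors m d p js"
proof -
  have "js \<in> multi_indices m s" using assms by (metis mset_in_multisets_of_size_iff)
  then show ?thesis using represents_sym_tensors[OF assms(1)] assms(2-4) unfolding represents_poly_def by blast
qed

text \<open>Termwise differentiation followed by \<open>sum_symmetric_deriv_prod\<close>. The
  resulting factor \<open>s\<close> is the one that block \<open>s\<close> of the Vandermonde-like
  matrix carries.\<close>

lemma partial_deriv_poly_eval:
  assumes p: "p \<in> poly_space m d" and x: "x \<in> R_pow m" and j: "j < m"
  shows "partial_deriv j (poly_eval p) x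
    = (\<Sum>s=1..d. \<Sum>js\<in>multi_indices m (s - 1). sym_tensors m d p (j # js) * (real s * (\<Prod>i\<leftarrow>js. x i)))"
proof -
  let ?\<Psi> = "sym_tensors m d p"
  \<comment> \<open>The expansion by tensors is known on \<open>R_pow m\<close> only, so the moved
    point must stay there.\<close>
  have "x(j := t) \<in> R_pow m" for t using x j by (auto simp: PiE_iff extensional_def)
  then have eval: "poly_eval p (x(j := t)) = (\<Sum>s=1..d. \<Sum>is\<in>multi_indices m s. ?\<Psi> is * (\<Prod>i\<leftarrow>is. (x(j := t)) i))" for t
    using represents_sym_tensors[OF p] unfolding represents_poly_def by blast
  have "((\<lambda>t. poly_eval p (x(j := t))) has_real_derivative
      (\<Sum>s=1..d. \<Sum>is\<in>multi_indices m s. ?\<Psi> is * deriv_prod x j is)) (at (x j))"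
    unfolding eval by (intro DERIV_sum DERIV_cmult has_derivative_prod)
  then have "partial_deriv j (poly_eval p) x = (\<Sum>s=1..d. \<Sum>is\<in>multi_indices m s. ?\<Psi> is * deriv_prod x j is)"
    unfolding partial_deriv_def by (rule DERIV_imp_deriv)
  also have "\<dots> = (\<Sum>s=1..d. real s * (\<Sum>js\<in>multi_indices m (s - 1). ?\<Psi> (j # js) * (\<Prod>i\<leftarrow>js. x i)))"
  proof (rule sum.cong)
    fix s assume s: "s \<in> {1..d}"
    then obtain r where r: "s = Suc r" by (cases s) auto
    show "(\<Sum>is\<in>multi_indices m s. ?\<Psi> is * deriv_prod x j is)
      = real s * (\<Sum>js\<in>multi_indices m (s - 1). ?\<Psi> (j # js) * (\<Prod>i\<leftarrow>js. x i))"
      unfolding r diff_Suc_1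
      by (rule sum_symmetric_deriv_prod[OF j]) (rule sym_tensors_symmetric[OF p s[unfolded r]])
  qed simp
  finally show ?thesis by (simp add: sum_distrib_left mult_ac)
qed


subsection \<open>Entries of the unfoldings and of the Vandermonde-like matrix\<close>

text \<open>\<open>digits\<close> splits off the least significant digit, but
  \<open>kron_pow\<close> the most significant one; this recursion fits the latter.\<close>

lemma digits_snoc:
  assumes "c < m ^ Suc k"
  shows "digits m (Suc k) c = digits m k (c mod m ^ k) @ [c div m ^ k]"
  using assms
proof (induction k arbitrary: c)
  case (Suc k)
  then have "c div m < m ^ Suc k"
    by (intro less_mult_imp_div_less) (simp add: mult_ac)
  then have "digits m (Suc (Suc k)) c
      = c mod m # digits m k (c div m mod m ^ k) @ [c div m div m ^ k]"
    using Suc.IH[of "c div m"] by (simp del: digits.simps(2) add: digits.simps(2)[of m "Suc k"])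
  moreover have "m > 0" using Suc.prems by (cases m) auto
  then have "digits m (Suc k) (c mod m ^ Suc k) = c mod m # digits m k (c div m mod m ^ k)"
    by (simp add: mod_mult2_eq)
  ultimately show ?case by (simp add: div_mult2_eq del: digits.simps(2))
qed simp

lemma digits_inj: "c < m ^ k \<Longrightarrow> c' < m ^ k \<Longrightarrow> digits m k c = digits m k c' \<Longrightarrow> c = c'"
proof (induction k arbitrary: c c')
  case (Suc k)
  then have "c div m < m ^ k" "c' div m < m ^ k"
    by (auto intro!: less_mult_imp_div_less simp: mult_ac)
  with Suc show ?case by (metis digits.simps(2) list.inject mult_div_mod_eq)
qed simp

lemma digits_in_multi_indices: "m \<ge> 1 \<Longrightarrow> digits m k c \<in> multi_indices m k"
  by (induction k arbitrary: c) (auto simp: multi_indices_Suc)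

text \<open>Expansion in base \<open>m\<close> is injective below \<open>m ^ k\<close>, and there
  are just as many multi-indices.\<close>

lemma bij_betw_digits:
  assumes "m \<ge> 1"
  shows "bij_betw (digits m k) {..<m ^ k} (multi_indices m k)"
proof -
  have "inj_on (digits m k) {..<m ^ k}" by (auto intro: inj_onI digits_inj)
  moreover have "card (multi_indices m k) = m ^ k"
    using card_lists_length_eq[of "{..<m}" k] by (simp add: multi_indices_def conj_commute)
  ultimately have "digits m k ` {..<m ^ k} = multi_indices m k"
    using digits_in_multi_indices[OF assms]
    by (intro card_subset_eq) (auto simp: card_image)
  then show ?thesis using \<open>inj_on (digits m k) {..<m ^ k}\<close> by (simp add: bij_betw_def)
qed

lemma dim_kron_pow [simp]: "dim_vec (kron_pow x k) = dim_vec x ^ k"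
  by (induction k) (auto simp: kron_def)

text \<open>\<open>kron\<close> splits the position by quotient and remainder modulo
  \<open>m ^ k\<close>, as \<open>digits_snoc\<close> does; the order of the factors does not affect
  the product.\<close>

lemma kron_pow_index: "c < m ^ k \<Longrightarrow> kron_pow (vec m x) k $ c = (\<Prod>i\<leftarrow>digits m k c. x i)"
proof (induction k arbitrary: c)
  case (Suc k)
  then have "m ^ k > 0" by (cases m) auto
  moreover have "c div m ^ k < m"
    using Suc.prems by (intro less_mult_imp_div_less) simp
  ultimately show ?case
    using Suc by (simp add: kron_def digits_snoc del: digits.simps)
qed simp

lemma vec_of_list_append: "vec_of_list (xs @ ys) = vec_of_list xs @\<^sub>v vec_of_list ys"
  by (rule eq_vecI) (auto simp: vec_of_list_index nth_append)

text \<open>Blocks that all list values of one function \<open>g\<close> merge into a single list,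
  whose entries can be read by one index.\<close>

lemma vec_concat_map:
  assumes "\<And>s. s \<in> set ss \<Longrightarrow> v s = vec_of_list (map g (L s))"
  shows "vec_concat (map v ss) = vec_of_list (map g (concat (map L ss)))"
  using assms by (induction ss) (auto simp: vec_concat_def vec_of_list_append)

text \<open>The common enumeration of the third mode of \<open>Q\<close> and of the rows of
  \<open>A\<close>: block \<open>s\<close> runs through the multi-indices of length
  \<open>s - 1\<close> in column-major order.\<close>

definition index_lists :: "nat \<Rightarrow> nat \<Rightarrow> nat list list" where
  "index_lists m d = concat (map (\<lambda>s. map (digits m (s - 1)) [0..<m ^ (s - 1)]) [1..<d + 1])"

lemma sum_list_map_index_lists:
  fixes G :: "nat list \<Rightarrow> 'a :: comm_monoid_add"
  assumes "m \<ge> 1"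
  shows "sum_list (map G (index_lists m d)) = (\<Sum>s=1..d. \<Sum>js\<in>multi_indices m (s - 1). G js)"
proof -
  have "sum_list (map G (map (digits m k) [0..<m ^ k])) = (\<Sum>js\<in>multi_indices m k. G js)" for k
    using sum.reindex_bij_betw[OF bij_betw_digits[OF assms], of G k]
    by (simp add: sum_list_distinct_conv_sum_set comp_def lessThan_atLeast0)
  moreover have "sum_list (map G (concat (map L ss))) = sum_list (map (\<lambda>s. sum_list (map G (L s))) ss)"
    for L :: "nat \<Rightarrow> nat list list" and ss
    by (induction ss) auto
  ultimately show ?thesis
    by (simp add: index_lists_def sum_list_distinct_conv_sum_set atLeastLessThanSuc_atLeastAtMost del: upt_Suc)
qed

lemma length_index_lists: "length (index_lists m d) = delta m d"
  by (simp add: index_lists_def delta_def length_concat comp_def sum_list_distinct_conv_sum_set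
      atLeastLessThanSuc_atLeastAtMost del: upt_Suc)

lemma sum_index_lists:
  assumes "m \<ge> 1"
  shows "(\<Sum>p<delta m d. G (index_lists m d ! p)) = (\<Sum>s=1..d. \<Sum>js\<in>multi_indices m (s - 1). G js)"
  using sum_list_map_index_lists[OF assms, of G d]
  by (simp add: sum_list_sum_nth length_index_lists lessThan_atLeast0)

lemma set_index_lists:
  assumes "m \<ge> 1"
  shows "set (index_lists m d) = (\<Union>s\<in>{1..d}. multi_indices m (s - 1))"
proof -
  have "digits m k ` {0..<m ^ k} = multi_indices m k" for k
    using bij_betw_digits[OF assms, of k] by (simp add: bij_betw_def lessThan_atLeast0)
  then show ?thesis
    by (simp add: index_lists_def atLeastLessThanSuc_atLeastAtMost del: upt_Suc)
qed

lemma vandermonde_mat_carrier [simp]: "vandermonde_mat m d N u \<in> carrier_mat (delta m d) N"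
  by (simp add: vandermonde_mat_def mat_of_cols_def)

text \<open>Block \<open>k\<close> belongs to multi-indices of length \<open>k - 1\<close>, so its
  factor \<open>k\<close> is the length plus one.\<close>

lemma vandermonde_mat_index:
  assumes "p < delta m d" "l < N"
  shows "vandermonde_mat m d N u $$ (p, l)
    = real (length (index_lists m d ! p) + 1) * monom_val (u l) (mset (index_lists m d ! p))"
proof -
  let ?g = "\<lambda>js. real (length js + 1) * monom_val (u l) (mset js)"
  have "length (digits m k c) = k" for k c by (induction k arbitrary: c) auto
  then have "vec_concat (map (\<lambda>k. real k \<cdot>\<^sub>v kron_pow (vec m (u l)) (k - 1)) [1..<d + 1])
      = vec_of_list (map ?g (index_lists m d))"
    unfolding index_lists_def
    by (intro vec_concat_map eq_vecI) (auto simp: vec_of_list_index kron_pow_index monom_val_mset simp del: upt_Suc)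
  then show ?thesis
    using assms by (simp add: vandermonde_mat_def mat_of_cols_index vec_of_list_index length_index_lists del: upt_Suc)
qed

lemma unfolding_tensor_index:
  assumes "i < n" "j < m" "p < delta m d"
  shows "unfolding_tensor m n d f (i, j, p) = sym_tensors m d (f i) (j # index_lists m d ! p)"
proof -
  let ?T = "sym_tensors m d (f i)"
  have "vec_concat (map (\<lambda>s. row (unfolding1 m s ?T) j) [1..<d + 1])
      = vec_of_list (map (\<lambda>js. ?T (j # js)) (index_lists m d))"
    unfolding index_lists_def
  proof (rule vec_concat_map)
    fix s
    have "row (unfolding1 m s ?T) j = vectorize m (s - 1) (\<lambda>is. ?T (j # is))"
      using assms unfolding unfolding1_def by (subst mat_of_rows_row) (auto simp: vectorize_def)
    then show "row (unfolding1 m s ?T) j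
        = vec_of_list (map (\<lambda>js. ?T (j # js)) (map (digits m (s - 1)) [0..<m ^ (s - 1)]))"
      by (intro eq_vecI) (auto simp: vectorize_def vec_of_list_index)
  qed
  then show ?thesis
    using assms by (simp add: unfolding_tensor_def tensor3_def unfolding_matrix_def mat_of_rows_index
        vec_of_list_index length_index_lists del: upt_Suc)
qed

section \<open>The tensor of Jacobians as a mode product\<close>

lemma tensor3_index [simp]: "i < a \<Longrightarrow> j < b \<Longrightarrow> k < c \<Longrightarrow> tensor3 a b c T (i, j, k) = T i j k"
  by (simp add: tensor3_def)

lemma tensor3_cong:
  "(\<And>i j k. i < a \<Longrightarrow> j < b \<Longrightarrow> k < c \<Longrightarrow> T i j k = T' i j k) \<Longrightarrow> tensor3 a b c T = tensor3 a b c T'"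
  by (auto simp: tensor3_def intro!: restrict_ext)

text \<open>The derivative formula, with its sum over multi-indices turned into a sum over positions
  in \<open>index_lists\<close>, is the mode product entry by entry.\<close>

lemma jacobian_tensor_conv_unfolding_tensor:
  assumes "m \<ge> 1" and u: "u \<in> {..<N} \<rightarrow>\<^sub>E R_pow m" and f: "f \<in> poly_maps m n d"
  shows "jacobian_tensor m n N f u
    = mode3_prod n m (unfolding_tensor m n d f) (transpose_mat (vandermonde_mat m d N u))"
proof -
  have "partial_deriv j (poly_eval (f i)) (u l)
    = (\<Sum>p<delta m d. unfolding_tensor m n d f (i, j, p) * vandermonde_mat m d N u $$ (p, l))"
    if ijl: "i < n" "j < m" "l < N" for i j l
  proof -
    let ?G = "\<lambda>js. sym_tensors m d (f i) (j # js) * (real (length js + 1) * (\<Prod>i\<leftarrow>js. u l i))"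
    have "u l \<in> R_pow m" "f i \<in> poly_space m d" using u f ijl by (auto simp: poly_maps_def)
    then have "partial_deriv j (poly_eval (f i)) (u l) = (\<Sum>s=1..d. \<Sum>js\<in>multi_indices m (s - 1). ?G js)"
      using ijl by (subst partial_deriv_poly_eval) (auto intro!: sum.cong simp: multi_indices_def)
    also have "\<dots> = (\<Sum>p<delta m d. ?G (index_lists m d ! p))"
      by (rule sum_index_lists[OF \<open>m \<ge> 1\<close>, symmetric])
    finally show ?thesis
      using ijl by (simp add: unfolding_tensor_index vandermonde_mat_index monom_val_mset)
  qed
  then show ?thesis
    using carrier_matD[OF vandermonde_mat_carrier[of m d N u]]
    unfolding jacobian_tensor_def mode3_prod_def by (auto intro!: tensor3_cong)
qed

section \<open>The monomials behind the rows of the Vandermonde-like matrix\<close>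

definition low_monoms :: "nat \<Rightarrow> nat \<Rightarrow> nat multiset set" where
  "low_monoms m d = {T. set_mset T \<subseteq> {..<m} \<and> size T < d}"

lemma low_monoms_conv: "low_monoms m d = (\<Union>s<d. multisets_of_size {..<m} s)"
  by (auto simp: low_monoms_def multisets_of_size_def)

lemma finite_low_monoms [simp]: "finite (low_monoms m d)"
  by (auto simp: low_monoms_conv)

text \<open>Counting by degree gives the sum of \<open>(m - 1 + s) choose s\<close> over
  \<open>s < d\<close>, which the hockey-stick identity evaluates.\<close>

lemma card_low_monoms:
  assumes "m \<ge> 1" "d \<ge> 1"
  shows "card (low_monoms m d) = (m + d - 1) choose (d - 1)"
proof -
  have "card (low_monoms m d) = (\<Sum>s<d. card (multisets_of_size {..<m} s))"
    unfolding low_monoms_conv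
    by (rule card_UN_disjoint) (auto simp: finite_multisets_of_size dest!: multisets_of_size_size)
  also have "\<dots> = (\<Sum>s\<le>d - 1. (m - 1 + s) choose s)"
    using assms by (intro sum.cong) (auto simp: card_multisets_of_size)
  also have "\<dots> = (m + d - 1) choose (d - 1)"
  proof -
    have "Suc (m - 1 + (d - 1)) = m + d - 1" using assms by simp
    then show ?thesis by (simp only: sum_choose_lower)
  qed
  finally show ?thesis .
qed

text \<open>The rows run through all multi-indices of length less than \<open>d\<close>, so every
  monomial of degree less than \<open>d\<close> occurs; the weight, length plus one, is never
  zero.\<close>

lemma repeated_rows_vandermonde_mat:
  assumes "m \<ge> 1"
  shows "repeated_rows (vandermonde_mat m d N u) (delta m d) N (low_monoms m d)
    (\<lambda>p. real (length (index_lists m d ! p) + 1)) (\<lambda>p. mset (index_lists m d ! p)) (\<lambda>T l. monom_val (u l) T)"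
proof
  have set: "set (index_lists m d) = {js. mset js \<in> low_monoms m d}"
    unfolding set_index_lists[OF assms] by (force simp: low_monoms_def multi_indices_def)
  show "mset (index_lists m d ! p) \<in> low_monoms m d" if "p < delta m d" for p
    using nth_mem[of p "index_lists m d"] that by (simp add: set length_index_lists)
  show "\<exists>p<delta m d. mset (index_lists m d ! p) = T" if "T \<in> low_monoms m d" for T
  proof -
    obtain js where js: "mset js = T" using ex_mset by blast
    then have "js \<in> set (index_lists m d)" using that by (simp add: set)
    then show ?thesis using js by (auto simp: in_set_conv_nth length_index_lists)
  qed
qed (auto simp: vandermonde_mat_index)


subsection \<open>Minimal CP decompositions\<close>

lemma cp_decomp_iff:
  "cp_decomp a b c T r x y z \<longleftrightarrow>
     (\<forall>k<r. x k \<in> carrier_vec a \<and> y k \<in> carrier_vec b \<and> z k \<in> carrier_vec c) \<and>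
     T = tensor3 a b c (\<lambda>i j l. \<Sum>k<r. x k $ i * y k $ j * z k $ l)"
proof -
  have "tensor3 a b c (\<lambda>i j l. \<Sum>k<r. outer3 (x k) (y k) (z k) (i, j, l))
      = tensor3 a b c (\<lambda>i j l. \<Sum>k<r. x k $ i * y k $ j * z k $ l)"
    if "\<forall>k<r. x k \<in> carrier_vec a \<and> y k \<in> carrier_vec b \<and> z k \<in> carrier_vec c"
    using that by (intro tensor3_cong sum.cong) (auto simp: outer3_def)
  then show ?thesis unfolding cp_decomp_def by auto
qed

lemma cp_decomp_index:
  assumes "cp_decomp a b c T r x y z" "i < a" "j < b" "l < c"
  shows "T (i, j, l) = (\<Sum>k<r. x k $ i * y k $ j * z k $ l)"
  using assms by (simp add: cp_decomp_iff)

lemma mult_mat_vec_index_sum: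
  fixes B :: "'a :: comm_semiring_0 mat"
  assumes "B \<in> carrier_mat r c" "v \<in> carrier_vec c" "i < r"
  shows "(B *\<^sub>v v) $ i = (\<Sum>p<c. v $ p * B $$ (i, p))"
  using assms by (auto simp: scalar_prod_def lessThan_atLeast0 mult.commute intro!: sum.cong)

lemma minimal_cp_decomp_carrier:
  assumes "minimal_cp_decomp a b c T r x y z" "k < r"
  shows "x k \<in> carrier_vec a" "y k \<in> carrier_vec b" "z k \<in> carrier_vec c"
  using assms unfolding minimal_cp_decomp_def cp_decomp_def by blast+

text \<open>The mode product is linear and acts on the third factors alone.\<close>

lemma cp_decomp_mode3_prod:
  assumes T: "cp_decomp a b c T r x y z" and B: "B \<in> carrier_mat c' c"
  shows "cp_decomp a b c' (mode3_prod a b T B) r x y (\<lambda>k. B *\<^sub>v z k)"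
proof -
  have "(\<Sum>p<c. T (i, j, p) * B $$ (l, p)) = (\<Sum>k<r. x k $ i * y k $ j * (B *\<^sub>v z k) $ l)"
    if "i < a" "j < b" "l < c'" for i j l
  proof -
    have "(\<Sum>p<c. T (i, j, p) * B $$ (l, p))
      = (\<Sum>p<c. \<Sum>k<r. x k $ i * y k $ j * (z k $ p * B $$ (l, p)))"
      using that by (simp add: cp_decomp_index[OF T] sum_distrib_right mult.assoc)
    also have "\<dots> = (\<Sum>k<r. x k $ i * y k $ j * (\<Sum>p<c. z k $ p * B $$ (l, p)))"
      by (subst sum.swap) (simp add: sum_distrib_left)
    also have "\<dots> = (\<Sum>k<r. x k $ i * y k $ j * (B *\<^sub>v z k) $ l)"
      using T that by (intro sum.cong) (auto simp: mult_mat_vec_index_sum[OF B] cp_decomp_iff)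
    finally show ?thesis .
  qed
  moreover have "B *\<^sub>v z k \<in> carrier_vec c'" if "k < r" for k
    using B by (intro carrier_vecI) simp
  ultimately show ?thesis
    using T B unfolding cp_decomp_iff mode3_prod_def by (auto intro!: tensor3_cong)
qed

lemma outer3_conv_tensor3:
  assumes "x \<in> carrier_vec a" "y \<in> carrier_vec b" "z \<in> carrier_vec c"
  shows "outer3 x y z = tensor3 a b c (\<lambda>i j l. x $ i * y $ j * z $ l)"
  using assms by (simp add: outer3_def)

text \<open>The image of a rank-one term depends on the term only and not on its splitting into
  factors, so equal terms have equal images.\<close>

lemma outer3_mult_mat_vec:
  assumes "x \<in> carrier_vec a" "y \<in> carrier_vec b" "z \<in> carrier_vec c" and B: "B \<in> carrier_mat c' c"
  shows "outer3 x y (B *\<^sub>v z) = mode3_prod a b (outer3 x y z) B"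
proof -
  have "cp_decomp a b c (outer3 x y z) 1 (\<lambda>_. x) (\<lambda>_. y) (\<lambda>_. z)"
    using assms by (simp add: cp_decomp_iff outer3_conv_tensor3)
  from cp_decomp_mode3_prod[OF this B] show ?thesis
    by (simp add: cp_decomp_iff outer3_conv_tensor3)
qed

lemma cp_rank_le: "cp_decomp a b c T r x y z \<Longrightarrow> cp_rank a b c T \<le> r"
  unfolding cp_rank_def by (rule Least_le) blast

text \<open>A dependency among the \<open>x k \<circ> y k\<close> would allow us to eliminate the term \<open>k0\<close>.\<close>

lemma minimal_cp_decomp_independent:
  assumes min: "minimal_cp_decomp a b c T r x y z"
    and dep: "\<And>i j. i < a \<Longrightarrow> j < b \<Longrightarrow> (\<Sum>k<r. \<alpha> k * (x k $ i * y k $ j)) = 0" and k0: "k0 < r"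
  shows "\<alpha> k0 = 0"
proof (rule ccontr)
  assume \<alpha>: "\<alpha> k0 \<noteq> 0"
  have T: "cp_decomp a b c T r x y z" and r: "r = cp_rank a b c T"
    using min by (auto simp: minimal_cp_decomp_def)
  have "card ({..<r} - {k0}) = r - 1" using k0 by simp
  \<comment> \<open>The remaining terms are renumbered, since decompositions are indexed by an
    initial segment.\<close>
  then obtain \<sigma> where \<sigma>: "bij_betw \<sigma> {..<r - 1} ({..<r} - {k0})"
    using ex_bij_betw_nat_finite[of "{..<r} - {k0}"] by (auto simp: lessThan_atLeast0)
  \<comment> \<open>Solving the relation for the product of \<open>x k0\<close> and
    \<open>y k0\<close> and substituting moves multiples of \<open>z k0\<close> into the other third
    factors.\<close>
  define z' where "z' = (\<lambda>k. z k - (\<alpha> k / \<alpha> k0) \<cdot>\<^sub>v z k0)"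
  have z: "z k \<in> carrier_vec c" if "k < r" for k using T that by (auto simp: cp_decomp_iff)
  have \<sigma>r: "\<sigma> k < r" if "k < r - 1" for k using \<sigma> that by (auto simp: bij_betw_def)
  have "(\<Sum>k<r. x k $ i * y k $ j * z k $ l) = (\<Sum>k<r - 1. x (\<sigma> k) $ i * y (\<sigma> k) $ j * z' (\<sigma> k) $ l)"
    if ijl: "i < a" "j < b" "l < c" for i j l
  proof -
    let ?s = "\<lambda>g. \<Sum>k\<in>{..<r} - {k0}. g k"
    have "\<alpha> k0 * (x k0 $ i * y k0 $ j) + ?s (\<lambda>k. \<alpha> k * (x k $ i * y k $ j)) = 0"
      using dep[OF ijl(1,2)] k0 by (subst (asm) sum.remove[of _ k0]) auto
    then have s: "?s (\<lambda>k. \<alpha> k * (x k $ i * y k $ j)) = - \<alpha> k0 * (x k0 $ i * y k0 $ j)" by simp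
    have "(\<Sum>k<r - 1. x (\<sigma> k) $ i * y (\<sigma> k) $ j * z' (\<sigma> k) $ l) = ?s (\<lambda>k. x k $ i * y k $ j * z' k $ l)"
      by (rule sum.reindex_bij_betw[OF \<sigma>])
    also have "\<dots> = ?s (\<lambda>k. x k $ i * y k $ j * z k $ l - z k0 $ l / \<alpha> k0 * (\<alpha> k * (x k $ i * y k $ j)))"
      using ijl z k0 by (intro sum.cong) (auto simp: z'_def algebra_simps carrier_vecD[OF z])
    also have "\<dots> = ?s (\<lambda>k. x k $ i * y k $ j * z k $ l) - z k0 $ l / \<alpha> k0 * ?s (\<lambda>k. \<alpha> k * (x k $ i * y k $ j))"
      by (simp add: sum_subtractf sum_distrib_left)
    also have "\<dots> = (\<Sum>k<r. x k $ i * y k $ j * z k $ l)"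
      using \<alpha> k0 unfolding s by (subst sum.remove[of _ k0]) auto
    finally show ?thesis by simp
  qed
  moreover have "z' k \<in> carrier_vec c" if "k < r" for k
    using z k0 that by (simp add: z'_def)
  ultimately have "cp_decomp a b c T (r - 1) (x \<circ> \<sigma>) (y \<circ> \<sigma>) (z' \<circ> \<sigma>)"
    using T \<sigma>r unfolding cp_decomp_iff by (auto intro!: tensor3_cong)
  then show False using cp_rank_le r k0 by fastforce
qed

text \<open>\<open>B\<close> and \<open>G\<close> undo each other on the two given tensors only.
  This suits \<open>transpose_mat A\<close>, which in general has a nontrivial kernel.\<close>

locale mode3_equivalence =
  fixes n m c c' :: nat and Q J :: tensor3 and B G :: "real mat"
  assumes B: "B \<in> carrier_mat c' c" and G: "G \<in> carrier_mat c c'"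
    and J: "J = mode3_prod n m Q B" and Q: "Q = mode3_prod n m J G"
begin

lemma cp_decomp_J: "cp_decomp n m c Q r x y z \<Longrightarrow> cp_decomp n m c' J r x y (\<lambda>k. B *\<^sub>v z k)"
  using cp_decomp_mode3_prod[OF _ B] by (simp add: J)

lemma cp_decomp_Q: "cp_decomp n m c' J r x y h \<Longrightarrow> cp_decomp n m c Q r x y (\<lambda>k. G *\<^sub>v h k)"
  by (subst Q) (rule cp_decomp_mode3_prod[OF _ G])

lemma cp_rank_eq: "cp_rank n m c' J = cp_rank n m c Q"
  unfolding cp_rank_def using cp_decomp_J cp_decomp_Q by metis

lemma minimal_cp_decomp_J:
  "minimal_cp_decomp n m c Q r x y z \<Longrightarrow> minimal_cp_decomp n m c' J r x y (\<lambda>k. B *\<^sub>v z k)"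
  using cp_decomp_J unfolding minimal_cp_decomp_def cp_rank_eq by blast

text \<open>The witness is \<open>G *\<^sub>v h k\<close>. Mapping it back by \<open>B\<close> gives
  a second decomposition of \<open>J\<close> with the same first two factors, and minimality forces
  the third factors to agree.\<close>

lemma minimal_cp_decomp_Q:
  assumes min: "minimal_cp_decomp n m c' J r x y h"
  shows "\<exists>z. minimal_cp_decomp n m c Q r x y z \<and> (\<forall>k<r. h k = B *\<^sub>v z k)"
proof (intro exI conjI allI impI)
  let ?z = "\<lambda>k. G *\<^sub>v h k"
  have h: "cp_decomp n m c' J r x y h" using min unfolding minimal_cp_decomp_def by blast
  show "minimal_cp_decomp n m c Q r x y ?z"
    using min cp_decomp_Q unfolding minimal_cp_decomp_def cp_rank_eq by blast
  fix k assume k: "k < r"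
  have Bz: "cp_decomp n m c' J r x y (\<lambda>k. B *\<^sub>v ?z k)" by (intro cp_decomp_J cp_decomp_Q h)
  show "h k = B *\<^sub>v ?z k"
  proof (rule eq_vecI)
    show "dim_vec (h k) = dim_vec (B *\<^sub>v ?z k)" using h k B by (auto simp: cp_decomp_iff)
    fix l assume "l < dim_vec (B *\<^sub>v ?z k)"
    then have l: "l < c'" using B by simp
    \<comment> \<open>For fixed \<open>l\<close> the differences are the coefficients of a vanishing
      combination of the matrices formed from \<open>x k\<close> and \<open>y k\<close>.\<close>
    have "h k $ l - (B *\<^sub>v ?z k) $ l = 0"
    proof (rule minimal_cp_decomp_independent[OF min _ k])
      fix i j assume ij: "i < n" "j < m"
      have "(\<Sum>k<r. (h k $ l - (B *\<^sub>v ?z k) $ l) * (x k $ i * y k $ j))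
        = (\<Sum>k<r. x k $ i * y k $ j * h k $ l) - (\<Sum>k<r. x k $ i * y k $ j * (B *\<^sub>v ?z k) $ l)"
        unfolding sum_subtractf[symmetric] by (simp add: algebra_simps)
      also have "\<dots> = 0"
        using cp_decomp_index[OF h ij l] cp_decomp_index[OF Bz ij l] by simp
      finally show "(\<Sum>k<r. (h k $ l - (B *\<^sub>v ?z k) $ l) * (x k $ i * y k $ j)) = 0" .
    qed
    then show "h k $ l = (B *\<^sub>v ?z k) $ l" by simp
  qed
qed

text \<open>Both decompositions lift to \<open>Q\<close>, where uniqueness matches the rank-one
  terms; \<open>B\<close> maps matched terms to matched terms of \<open>J\<close>.\<close>

lemma unique_minimal_cp_J:
  assumes uniq: "unique_minimal_cp n m c Q"
  shows "unique_minimal_cp n m c' J"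
  unfolding unique_minimal_cp_def
proof (intro allI impI)
  fix r x y h x' y' h'
  assume h: "minimal_cp_decomp n m c' J r x y h" and h': "minimal_cp_decomp n m c' J r x' y' h'"
  obtain z where z: "minimal_cp_decomp n m c Q r x y z" "\<forall>k<r. h k = B *\<^sub>v z k"
    using minimal_cp_decomp_Q[OF h] by blast
  obtain z' where z': "minimal_cp_decomp n m c Q r x' y' z'" "\<forall>k<r. h' k = B *\<^sub>v z' k"
    using minimal_cp_decomp_Q[OF h'] by blast
  obtain \<pi> where \<pi>: "\<pi> permutes {..<r}"
    "\<And>k. k < r \<Longrightarrow> outer3 (x k) (y k) (z k) = outer3 (x' (\<pi> k)) (y' (\<pi> k)) (z' (\<pi> k))"
    using uniq z(1) z'(1) unfolding unique_minimal_cp_def by blast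
  have "outer3 (x k) (y k) (h k) = outer3 (x' (\<pi> k)) (y' (\<pi> k)) (h' (\<pi> k))" if k: "k < r" for k
  proof -
    have \<pi>k: "\<pi> k < r" using permutes_in_image[OF \<pi>(1), of k] k by simp
    have "outer3 (x k) (y k) (B *\<^sub>v z k) = mode3_prod n m (outer3 (x k) (y k) (z k)) B"
      using minimal_cp_decomp_carrier[OF z(1) k] B by (rule outer3_mult_mat_vec)
    also have "\<dots> = outer3 (x' (\<pi> k)) (y' (\<pi> k)) (B *\<^sub>v z' (\<pi> k))"
      unfolding \<pi>(2)[OF k] using minimal_cp_decomp_carrier[OF z'(1) \<pi>k] B
      by (rule outer3_mult_mat_vec[symmetric])
    finally show ?thesis using z(2) z'(2) k \<pi>k by simp
  qed
  with \<pi>(1) show "\<exists>\<pi>. \<pi> permutes {..<r} \<and>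
      (\<forall>k<r. outer3 (x k) (y k) (h k) = outer3 (x' (\<pi> k)) (y' (\<pi> k)) (h' (\<pi> k)))" by blast
qed

end


subsection \<open>Generic and random points\<close>

lemma monom_val_sum: "monom_val x (\<Sum>i\<in>I. T i) = (\<Prod>i\<in>I. monom_val x (T i))"
  by (induction I rule: infinite_finite_induct) auto

lemma monom_val_image_mset: "monom_val x (image_mset f T) = monom_val (x \<circ> f) T"
  by (simp add: monom_val_def multiset.map_comp comp_def)

text \<open>Monomials \<open>T i\<close> may coincide for different \<open>i\<close>; their
  coefficients then add up in the formal polynomial.\<close>

lemma exists_poly_eval:
  assumes "finite I" "\<And>i. i \<in> I \<Longrightarrow> set_mset (T i) \<subseteq> V"
  shows "\<exists>p\<in>polys_in V. \<forall>x. poly_eval p x = (\<Sum>i\<in>I. c i * monom_val x (T i))"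
proof -
  define p where "p = (\<Sum>i\<in>I. Poly_Mapping.single (exponents (T i)) (c i))"
  have keys: "keys p \<subseteq> exponents ` T ` I"
    unfolding p_def using Poly_Mapping.keys_sum[of "\<lambda>i. Poly_Mapping.single (exponents (T i)) (c i)" I]
    by (auto split: if_splits)
  have "poly_eval p x = (\<Sum>i\<in>I. c i * monom_val x (T i))" for x
  proof -
    have "lookup p (exponents S) = (\<Sum>i\<in>{i \<in> I. T i = S}. c i)" for S
      using assms(1) by (auto simp: p_def Poly_Mapping.lookup_sum lookup_single when_def
          inj_eq[OF inj_exponents] sum.inter_filter)
    then have "poly_eval p x = (\<Sum>S\<in>T ` I. \<Sum>i\<in>{i \<in> I. T i = S}. c i * monom_val x (T i))"
      using assms(1) keys by (subst poly_eval_conv_sum) (auto simp: sum_distrib_right intro!: sum.cong)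
    also have "\<dots> = (\<Sum>i\<in>I. c i * monom_val x (T i))"
      using assms(1) by (intro sum.group) auto
    finally show ?thesis .
  qed
  moreover have "p \<in> polys_in V"
    using keys assms(2) by (fastforce simp: polys_in_def)
  ultimately show ?thesis by blast
qed

text \<open>The Leibniz formula makes the determinant one polynomial in the coordinates of all
  points.\<close>

lemma algebraic_subset_det_monoms:
  assumes "\<And>t. t < M \<Longrightarrow> set_mset (\<tau> t) \<subseteq> {..<m}"
  shows "algebraic_subset M m
    {x \<in> {..<M} \<rightarrow>\<^sub>E R_pow m. det (mat M M (\<lambda>(s, t). monom_val (x s) (\<tau> t))) = 0}"
proof -
  \<comment> \<open>The monomial of a permutation; \<open>Pair s\<close> renames the variables of
    \<open>\<tau> (\<pi> s)\<close> to the coordinates of point \<open>s\<close>.\<close>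
  define T where "T = (\<lambda>\<pi>. \<Sum>s<M. image_mset (Pair s) (\<tau> (\<pi> s)))"
  have "set_mset (T \<pi>) \<subseteq> {..<M} \<times> {..<m}" if "\<pi> \<in> {\<pi>. \<pi> permutes {0..<M}}" for \<pi>
    using assms permutes_less[of \<pi> M] that by (fastforce simp: T_def set_mset_sum)
  then obtain p where p: "p \<in> polys_in ({..<M} \<times> {..<m})"
    "\<And>x. poly_eval p x = (\<Sum>\<pi> | \<pi> permutes {0..<M}. signof \<pi> * monom_val x (T \<pi>))"
    using exists_poly_eval[of "{\<pi>. \<pi> permutes {0..<M}}" T "{..<M} \<times> {..<m}" signof]
    by (auto simp: finite_permutations)
  have "det (mat M M (\<lambda>(s, t). monom_val (x s) (\<tau> t))) = poly_eval p (\<lambda>(k, i). x k i)" for x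
    unfolding p(2) det_def T_def monom_val_sum monom_val_image_mset
    by (auto intro!: sum.cong prod.cong simp: permutes_less comp_def lessThan_atLeast0)
  then show ?thesis
    unfolding algebraic_subset_def using p(1) by (intro exI[of _ "{p}"]) auto
qed

text \<open>A nontrivial combination of distinct monomials vanishes only on a Lebesgue null set,
  which is null for \<open>\<mu>\<close> by absolute continuity; this is the condition on
  combinations in \<open>AE_det_nonzero\<close>.\<close>

lemma AE_det_monoms_nonzero:
  assumes "sigma_finite_measure \<mu>" and sets: "sets \<mu> = sets (Pi\<^sub>M {..<m} (\<lambda>_. lborel))"
    and ac: "absolutely_continuous (Pi\<^sub>M {..<m} (\<lambda>_. lborel)) \<mu>"
    and inj: "inj_on \<tau> {..<M}" and \<tau>: "\<And>t. t < M \<Longrightarrow> set_mset (\<tau> t) \<subseteq> {..<m::nat}"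
  shows "AE x in Pi\<^sub>M {..<M} (\<lambda>_. \<mu>). det (mat M M (\<lambda>(s, t). monom_val (x s) (\<tau> t))) \<noteq> 0"
proof (rule AE_det_nonzero[OF assms(1), of M "\<lambda>t x. monom_val x (\<tau> t)" M])
  show "(\<lambda>x. monom_val x (\<tau> t)) \<in> borel_measurable \<mu>" if "t < M" for t
    unfolding measurable_cong_sets[OF sets refl] using \<tau>[OF that] by (intro measurable_monom_val) auto
  fix c :: "nat \<Rightarrow> real" and t assume t: "t < M" "c t \<noteq> 0"
  define c' where "c' = c \<circ> the_inv_into {..<M} \<tau>"
  have c': "c' (\<tau> t) = c t" if "t < M" for t
    using that inj by (simp add: c'_def the_inv_into_f_f)
  have "AE x in Pi\<^sub>M {..<m} (\<lambda>_. lborel). (\<Sum>T\<in>\<tau> ` {..<M}. c' T * monom_val x T) \<noteq> 0"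
    by (rule AE_polynomial_nonzero[of _ _ "\<tau> t"]) (use t \<tau> c' in auto)
  then have "AE x in Pi\<^sub>M {..<m} (\<lambda>_. lborel). (\<Sum>t<M. c t * monom_val x (\<tau> t)) \<noteq> 0"
    by (simp add: sum.reindex[OF inj] c')
  then show "AE x in \<mu>. (\<Sum>t<M. c t * monom_val x (\<tau> t)) \<noteq> 0"
    by (rule absolutely_continuous_AE[OF sets ac])
qed simp

text \<open>Almost every tuple for Lebesgue measure will do, and the space of tuples is not null.
  This makes the exceptional algebraic set proper.\<close>

lemma exists_det_monoms_nonzero:
  assumes "inj_on \<tau> {..<M}" "\<And>t. t < M \<Longrightarrow> set_mset (\<tau> t) \<subseteq> {..<m::nat}"
  shows "\<exists>x\<in>{..<M} \<rightarrow>\<^sub>E R_pow m. det (mat M M (\<lambda>(s, t). monom_val (x s) (\<tau> t))) \<noteq> 0"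
proof (rule ccontr)
  let ?L = "Pi\<^sub>M {..<m} (\<lambda>_. lborel :: real measure)"
  assume none: "\<not> ?thesis"
  interpret product_sigma_finite "\<lambda>_::nat. lborel :: real measure" by standard
  have L: "sigma_finite_measure ?L" by (rule sigma_finite) simp
  have "AE x in Pi\<^sub>M {..<M} (\<lambda>_. ?L). det (mat M M (\<lambda>(s, t). monom_val (x s) (\<tau> t))) \<noteq> 0"
    using assms by (intro AE_det_monoms_nonzero[OF L]) (auto simp: absolutely_continuous_def)
  then have "AE x in Pi\<^sub>M {..<M} (\<lambda>_. ?L). False"
    by (rule AE_mp[OF _ AE_I2]) (use none in \<open>simp add: space_PiM\<close>)
  then have "emeasure (Pi\<^sub>M {..<M} (\<lambda>_. ?L)) (space (Pi\<^sub>M {..<M} (\<lambda>_. ?L))) = 0"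
    by (simp add: AE_iff_null null_setsD1)
  moreover have "emeasure ?L (space ?L) \<noteq> 0"
    by (rule emeasure_space_PiM_nonzero) (simp_all add: lborel.sigma_finite_measure_axioms)
  ultimately show False
    using emeasure_space_PiM_nonzero[OF L] by blast
qed

text \<open>By independence the joint law of the first \<open>M\<close> points is a power of
  \<open>\<mu>\<close>, for which the determinant is almost surely nonzero.\<close>

lemma AE_full_rank_of_random_points:
  fixes U :: "nat \<Rightarrow> 'a \<Rightarrow> nat \<Rightarrow> real"
  assumes "m \<ge> 1" and \<tau>: "bij_betw \<tau> {..<M} (low_monoms m d)" and "M \<ge> 1" "M \<le> N"
    and P: "prob_space P" and \<mu>: "prob_space \<mu>" and sets: "sets \<mu> = sets (Pi\<^sub>M {..<m} (\<lambda>_. lborel))"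
    and ac: "absolutely_continuous (Pi\<^sub>M {..<m} (\<lambda>_. lborel)) \<mu>"
    and indep: "prob_space.indep_vars P (\<lambda>_. Pi\<^sub>M {..<m} (\<lambda>_. lborel)) U {..<N}"
    and distr: "\<And>j. j < N \<Longrightarrow> distr P (Pi\<^sub>M {..<m} (\<lambda>_. lborel)) (U j) = \<mu>"
  shows "AE \<omega> in P. mat_rank (vandermonde_mat m d N (\<lambda>j. U j \<omega>)) = M"
proof -
  interpret P: prob_space P by (rule P)
  interpret \<mu>: prob_space \<mu> by (rule \<mu>)
  interpret repeated_rows "vandermonde_mat m d N u" "delta m d" N "low_monoms m d"
    "\<lambda>p. real (length (index_lists m d ! p) + 1)" "\<lambda>p. mset (index_lists m d ! p)" "\<lambda>T l. monom_val (u l) T" for u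
    by (rule repeated_rows_vandermonde_mat[OF \<open>m \<ge> 1\<close>])
  let ?L = "Pi\<^sub>M {..<m} (\<lambda>_. lborel :: real measure)"
  let ?D = "\<lambda>x. det (mat M M (\<lambda>(s, t). monom_val (x s) (\<tau> t)))"
  let ?X = "\<lambda>\<omega>. \<lambda>i\<in>{..<M}. U i \<omega>"
  have \<tau>m: "set_mset (\<tau> t) \<subseteq> {..<m}" if "t < M" for t
    using that \<tau> by (auto simp: bij_betw_def low_monoms_def)
  have indepM: "P.indep_vars (\<lambda>_. ?L) U {..<M}"
    using \<open>M \<le> N\<close> by (intro P.indep_vars_subset[OF indep]) auto
  then have rv: "P.random_variable ?L (U i)" if "i \<in> {..<M}" for i
    using that by (auto simp: P.indep_vars_def)
  \<comment> \<open>\<open>M \<ge> 1\<close> makes the index set nonempty, as the description of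
    independence by product laws demands.\<close>
  have "distr P (Pi\<^sub>M {..<M} (\<lambda>_. ?L)) ?X = Pi\<^sub>M {..<M} (\<lambda>i. distr P ?L (U i))"
    using indepM \<open>M \<ge> 1\<close> by (subst P.indep_vars_iff_distr_eq_PiM'[symmetric]) (auto intro: rv simp: lessThan_empty_iff)
  also have "\<dots> = Pi\<^sub>M {..<M} (\<lambda>_. \<mu>)"
    using \<open>M \<le> N\<close> by (intro PiM_cong) (auto simp: distr)
  finally have dX: "distr P (Pi\<^sub>M {..<M} (\<lambda>_. ?L)) ?X = Pi\<^sub>M {..<M} (\<lambda>_. \<mu>)" .
  have "(\<lambda>x. ?D x) \<in> borel_measurable (Pi\<^sub>M {..<M} (\<lambda>_. ?L))"
  proof (rule measurable_det)
    fix s t assume "s < M" "t < M"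
    then show "(\<lambda>x. monom_val (x s) (\<tau> t)) \<in> borel_measurable (Pi\<^sub>M {..<M} (\<lambda>_. ?L))"
      by (intro measurable_compose[where f = "\<lambda>x. x s" and N = ?L and g = "\<lambda>y. monom_val y (\<tau> t)",
          OF measurable_component_singleton[where M = "\<lambda>_. ?L"] measurable_monom_val])
        (simp_all add: \<tau>m)
  qed
  then have meas: "{x \<in> space (Pi\<^sub>M {..<M} (\<lambda>_. ?L)). ?D x \<noteq> 0} \<in> sets (Pi\<^sub>M {..<M} (\<lambda>_. ?L))"
    by measurable
  have X: "?X \<in> P \<rightarrow>\<^sub>M Pi\<^sub>M {..<M} (\<lambda>_. ?L)"
    using rv by (intro measurable_restrict) auto
  have "AE x in distr P (Pi\<^sub>M {..<M} (\<lambda>_. ?L)) ?X. ?D x \<noteq> 0"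
    unfolding dX using \<tau> \<tau>m
    by (intro AE_det_monoms_nonzero[OF \<mu>.sigma_finite_measure_axioms sets ac]) (auto simp: bij_betw_def)
  then have "AE \<omega> in P. ?D (?X \<omega>) \<noteq> 0"
    unfolding AE_distr_iff[OF X meas] .
  then show ?thesis
  proof eventually_elim
    case (elim \<omega>)
    have "mat M M (\<lambda>(s, t). monom_val (?X \<omega> s) (\<tau> t)) = mat M M (\<lambda>(s, t). monom_val (U s \<omega>) (\<tau> t))"
      by (intro eq_matI) auto
    with elim show ?case
      using \<open>M \<le> N\<close> by (intro full_rank_if_det_nonzero[OF \<tau>, of "\<lambda>s. s"]) auto
  qed
qed

text \<open>Entries of \<open>Q\<close> at multi-indices with the same multiset agree by symmetry,
  and so do the weights; hence the left inverse on such vectors recovers \<open>Q\<close> from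
  \<open>J\<close>.\<close>

lemma mode3_equivalence_of_full_rank:
  assumes "m \<ge> 1" and u: "u \<in> {..<N} \<rightarrow>\<^sub>E R_pow m" and f: "f \<in> poly_maps m n d"
    and rank: "mat_rank (vandermonde_mat m d N u) = card (low_monoms m d)"
  shows "\<exists>G. mode3_equivalence n m (delta m d) N (unfolding_tensor m n d f) (jacobian_tensor m n N f u)
    (transpose_mat (vandermonde_mat m d N u)) G"
proof -
  let ?A = "vandermonde_mat m d N u" and ?Q = "unfolding_tensor m n d f" and ?J = "jacobian_tensor m n N f u"
  let ?L = "\<lambda>p. index_lists m d ! p"
  interpret repeated_rows ?A "delta m d" N "low_monoms m d"
    "\<lambda>p. real (length (?L p) + 1)" "\<lambda>p. mset (?L p)" "\<lambda>T l. monom_val (u l) T"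
    by (rule repeated_rows_vandermonde_mat[OF \<open>m \<ge> 1\<close>])
  obtain G where G: "\<forall>z. (\<forall>p<delta m d. \<forall>q<delta m d. mset (?L p) = mset (?L q) \<longrightarrow>
      real (length (?L p) + 1) * z p = real (length (?L q) + 1) * z q) \<longrightarrow>
      (\<forall>p<delta m d. (\<Sum>l<N. G p l * (\<Sum>q<delta m d. ?A $$ (q, l) * z q)) = z p)"
    using left_inverse_on_constant_fibres[OF rank] by (rule exE)
  let ?G = "mat (delta m d) N (\<lambda>(p, l). G p l)"
  have J: "?J = mode3_prod n m ?Q (transpose_mat ?A)"
    using assms by (intro jacobian_tensor_conv_unfolding_tensor)
  have J_index: "?J (i, j, l) = (\<Sum>q<delta m d. ?A $$ (q, l) * ?Q (i, j, q))" if "i < n" "j < m" "l < N" for i j l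
    using that carrier_matD[OF A] by (simp add: J mode3_prod_def mult.commute)
  have "(\<Sum>l<N. ?J (i, j, l) * ?G $$ (p, l)) = sym_tensors m d (f i) (j # ?L p)"
    if ijp: "i < n" "j < m" "p < delta m d" for i j p
  proof -
    have "(\<Sum>l<N. ?J (i, j, l) * ?G $$ (p, l))
      = (\<Sum>l<N. G p l * (\<Sum>q<delta m d. ?A $$ (q, l) * ?Q (i, j, q)))"
      using ijp by (simp add: J_index mult.commute)
    also have "\<dots> = ?Q (i, j, p)"
    proof (rule G[THEN spec, THEN mp, rule_format, OF _ ijp(3)])
      fix p q assume pq: "p < delta m d" "q < delta m d" "mset (?L p) = mset (?L q)"
      have "?L p \<in> set (index_lists m d)" using pq by (simp add: length_index_lists)
      then obtain s where s: "s \<in> {1..d}" "?L p \<in> multi_indices m (s - 1)"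
        unfolding set_index_lists[OF \<open>m \<ge> 1\<close>] by blast
      then obtain k where "s = Suc k" by (cases s) auto
      \<comment> \<open>Prefixing \<open>j\<close> raises the length to \<open>s\<close>, an order
        at which the coefficient tensor is symmetric.\<close>
      then have "j # ?L p \<in> multi_indices m s" using s ijp by (auto simp: multi_indices_def)
      then have "sym_tensors m d (f i) (j # ?L p) = sym_tensors m d (f i) (j # ?L q)"
        using f ijp pq s by (intro sym_tensors_symmetric[of _ m d s]) (auto simp: poly_maps_def)
      then show "real (length (?L p) + 1) * ?Q (i, j, p) = real (length (?L q) + 1) * ?Q (i, j, q)"
        using pq ijp mset_eq_length[OF pq(3)] by (simp add: unfolding_tensor_index)
    qed
    finally show ?thesis using ijp by (simp add: unfolding_tensor_index)
  qed
  then have Q: "?Q = mode3_prod n m ?J ?G"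
    unfolding mode3_prod_def unfolding_tensor_def
    using unfolding_tensor_index[of _ n _ m _ d f]
    by (auto intro!: tensor3_cong simp: unfolding_tensor_def)
  show ?thesis
    using A J Q by (intro exI[of _ ?G]) (unfold_locales, auto)
qed

section \<open>Factorization, rank and CP decompositions together\<close>

theorem theorem1:
  fixes m n d M :: nat
  assumes "m \<ge> 1" and "n \<ge> 1" and "d \<ge> 1"
    and "M = (m + d - 1) choose (d - 1)"
  shows
    "(\<forall>N\<ge>1. \<forall>u\<in>{..<N} \<rightarrow>\<^sub>E R_pow m. \<forall>f\<in>poly_maps m n d.
        jacobian_tensor m n N f u
          = mode3_prod n m (unfolding_tensor m n d f) (transpose_mat (vandermonde_mat m d N u)))
     \<and>
     (\<forall>N\<ge>1. \<forall>u\<in>{..<N} \<rightarrow>\<^sub>E R_pow m. mat_rank (vandermonde_mat m d N u) \<le> M)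
     \<and>
     (\<exists>Z. algebraic_subset M m Z \<and> Z \<subset> ({..<M} \<rightarrow>\<^sub>E R_pow m) \<and>
        (\<forall>N\<ge>1. \<forall>u\<in>{..<N} \<rightarrow>\<^sub>E R_pow m.
           M \<le> N \<longrightarrow>
           (\<exists>\<sigma>\<in>{..<M} \<rightarrow> {..<N}. inj_on \<sigma> {..<M} \<and> restrict (\<lambda>k. u (\<sigma> k)) {..<M} \<notin> Z) \<longrightarrow>
           mat_rank (vandermonde_mat m d N u) = M))
     \<and>
     (\<forall>N\<ge>1. \<forall>(P :: 'a measure) (\<mu> :: (nat \<Rightarrow> real) measure) (U :: nat \<Rightarrow> 'a \<Rightarrow> nat \<Rightarrow> real).
        M \<le> N \<longrightarrow> prob_space P \<longrightarrow> prob_space \<mu> \<longrightarrow>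
        sets \<mu> = sets (Pi\<^sub>M {..<m} (\<lambda>_. lborel)) \<longrightarrow>
        absolutely_continuous (Pi\<^sub>M {..<m} (\<lambda>_. lborel)) \<mu> \<longrightarrow>
        prob_space.indep_vars P (\<lambda>_. Pi\<^sub>M {..<m} (\<lambda>_. lborel)) U {..<N} \<longrightarrow>
        (\<forall>j<N. distr P (Pi\<^sub>M {..<m} (\<lambda>_. lborel)) (U j) = \<mu>) \<longrightarrow>
        (AE \<omega> in P. mat_rank (vandermonde_mat m d N (\<lambda>j. U j \<omega>)) = M))
     \<and>
     (\<forall>N\<ge>1. \<forall>u\<in>{..<N} \<rightarrow>\<^sub>E R_pow m. \<forall>A Q J. \<forall>f\<in>poly_maps m n d.
        A = vandermonde_mat m d N u \<longrightarrow> mat_rank A = M \<longrightarrow>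
        Q = unfolding_tensor m n d f \<longrightarrow> J = jacobian_tensor m n N f u \<longrightarrow>
        cp_rank n m N J = cp_rank n m (delta m d) Q \<and>
        (\<forall>r w v z. minimal_cp_decomp n m (delta m d) Q r w v z \<longrightarrow>
           minimal_cp_decomp n m N J r w v (\<lambda>k. transpose_mat A *\<^sub>v z k)) \<and>
        (\<forall>r w v h. minimal_cp_decomp n m N J r w v h \<longrightarrow>
           (\<exists>z. minimal_cp_decomp n m (delta m d) Q r w v z \<and>
                (\<forall>k<r. h k = transpose_mat A *\<^sub>v z k))) \<and>
        (unique_minimal_cp n m (delta m d) Q \<longrightarrow> unique_minimal_cp n m N J))"
proof -
  define F where "F = low_monoms m d"
  have M: "M = card F" using assms by (simp add: F_def card_low_monoms)
  have "M \<ge> 1" using assms by (simp add: Suc_le_eq)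
  obtain \<tau> where \<tau>: "bij_betw \<tau> {..<M} F"
    using ex_bij_betw_nat_finite[of F] by (auto simp: M F_def lessThan_atLeast0)
  then have inj: "inj_on \<tau> {..<M}" by (simp add: bij_betw_def)
  have \<tau>m: "set_mset (\<tau> t) \<subseteq> {..<m}" if "t < M" for t
    using that \<tau> by (auto simp: bij_betw_def F_def low_monoms_def)
  note rows = repeated_rows_vandermonde_mat[OF \<open>m \<ge> 1\<close>, of d, folded F_def]
  have rank_le: "mat_rank (vandermonde_mat m d N u) \<le> M" for N u
    unfolding M by (rule repeated_rows.rank_le[OF rows])
  define D where "D = (\<lambda>x :: nat \<Rightarrow> nat \<Rightarrow> real. det (mat M M (\<lambda>(s, t). monom_val (x s) (\<tau> t))))"
  \<comment> \<open>The zero set of one determinant built from the monomials; neither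
    \<open>N\<close> nor the sampling points enter.\<close>
  define Z where "Z = {x \<in> {..<M} \<rightarrow>\<^sub>E R_pow m. D x = 0}"
  have alg: "algebraic_subset M m Z"
    unfolding Z_def D_def using \<tau>m by (rule algebraic_subset_det_monoms)
  have proper: "Z \<subset> ({..<M} \<rightarrow>\<^sub>E R_pow m)"
    using exists_det_monoms_nonzero[OF inj \<tau>m] unfolding Z_def D_def by blast
  have generic: "mat_rank (vandermonde_mat m d N u) = M"
    if u: "u \<in> {..<N} \<rightarrow>\<^sub>E R_pow m" and \<sigma>: "\<sigma> \<in> {..<M} \<rightarrow> {..<N}"
      and Z: "restrict (\<lambda>k. u (\<sigma> k)) {..<M} \<notin> Z" for N u \<sigma>
  proof -
    \<comment> \<open>Lying outside \<open>Z\<close> gives a nonzero determinant only for tuples in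
      the ambient space, so membership comes first.\<close>
    have "restrict (\<lambda>k. u (\<sigma> k)) {..<M} \<in> {..<M} \<rightarrow>\<^sub>E R_pow m"
      using u \<sigma> by (intro restrict_PiE_iff[THEN iffD2]) blast
    then have "D (restrict (\<lambda>k. u (\<sigma> k)) {..<M}) \<noteq> 0" using Z by (simp add: Z_def)
    moreover have "mat M M (\<lambda>(s, t). monom_val (restrict (\<lambda>k. u (\<sigma> k)) {..<M} s) (\<tau> t))
        = mat M M (\<lambda>(s, t). monom_val (u (\<sigma> s)) (\<tau> t))"
      by (intro eq_matI) auto
    ultimately show ?thesis
      using \<sigma> by (intro repeated_rows.full_rank_if_det_nonzero[OF rows \<tau>, of \<sigma>]) (auto simp: D_def)
  qed
  have cp: "cp_rank n m N J = cp_rank n m (delta m d) Q \<and>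
        (\<forall>r w v z. minimal_cp_decomp n m (delta m d) Q r w v z \<longrightarrow>
           minimal_cp_decomp n m N J r w v (\<lambda>k. transpose_mat A *\<^sub>v z k)) \<and>
        (\<forall>r w v h. minimal_cp_decomp n m N J r w v h \<longrightarrow>
           (\<exists>z. minimal_cp_decomp n m (delta m d) Q r w v z \<and>
                (\<forall>k<r. h k = transpose_mat A *\<^sub>v z k))) \<and>
        (unique_minimal_cp n m (delta m d) Q \<longrightarrow> unique_minimal_cp n m N J)"
    if u: "u \<in> {..<N} \<rightarrow>\<^sub>E R_pow m" and f: "f \<in> poly_maps m n d"
      and A: "A = vandermonde_mat m d N u" and rank: "mat_rank A = M"
      and Q: "Q = unfolding_tensor m n d f" and J: "J = jacobian_tensor m n N f u" for N u f A Q J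
  proof -
    obtain G where "mode3_equivalence n m (delta m d) N Q J (transpose_mat A) G"
      using mode3_equivalence_of_full_rank[OF \<open>m \<ge> 1\<close> u f] rank unfolding A Q J M F_def by blast
    then interpret mode3_equivalence n m "delta m d" N Q J "transpose_mat A" G .
    show ?thesis
      using cp_rank_eq minimal_cp_decomp_J minimal_cp_decomp_Q unique_minimal_cp_J by blast
  qed
  show ?thesis
  proof (intro conjI, goal_cases)
    case 1
    show ?case using jacobian_tensor_conv_unfolding_tensor[OF \<open>m \<ge> 1\<close>] by blast
  next
    case 2
    show ?case using rank_le by blast
  next
    case 3
    show ?case using alg proper generic by (intro exI[of _ Z]) blast
  next
    case 4
    show ?case
    proof (intro allI impI)
      fix N and P :: "'a measure" and \<mu> and U :: "nat \<Rightarrow> 'a \<Rightarrow> nat \<Rightarrow> real"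
      assume hyps: "M \<le> N" "prob_space P" "prob_space \<mu>" "sets \<mu> = sets (Pi\<^sub>M {..<m} (\<lambda>_. lborel))"
        "absolutely_continuous (Pi\<^sub>M {..<m} (\<lambda>_. lborel)) \<mu>"
        "prob_space.indep_vars P (\<lambda>_. Pi\<^sub>M {..<m} (\<lambda>_. lborel)) U {..<N}"
        and distr: "\<forall>j<N. distr P (Pi\<^sub>M {..<m} (\<lambda>_. lborel)) (U j) = \<mu>"
      show "AE \<omega> in P. mat_rank (vandermonde_mat m d N (\<lambda>j. U j \<omega>)) = M"
        by (rule AE_full_rank_of_random_points[OF \<open>m \<ge> 1\<close> \<tau>[unfolded F_def] \<open>M \<ge> 1\<close> hyps])
          (rule distr[rule_format])
    qed
  next
    case 5
    show ?case by (intro allI ballI impI) (rule cp)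
  qed
qed

end
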